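(* Let $\Gamma$ be a finite index subgroup of $\mathrm{SL}_2(\mathbb{Z})$. Let $\mathrm{Zeta}(\Gamma)$ be the set of $\Gamma$-elliptic zeta functions $\mathcal{Z}$ (of arbitrary integer weight) for which $\tau\mapsto\Psi_{[1,\tau]}$ is not identically zero. Let $M_2(\Gamma)$ be the space of weight 2 meromorphic modular forms for $\Gamma$, and let $Eq(\Gamma)$ be the set of $\Gamma$-equivariant functions other than $\tau\mapsto\tau$. Consider the maps $$\mathrm{Zeta}(\Gamma)\to M_2(\Gamma),\quad \mathcal{Z}\mapsto \frac{\Phi_{[1,\tau]}}{\Psi_{[1,\tau]}};\qquad M_2(\Gamma)\to Eq(\Gamma),\quad f\mapsto \frac{\tau f(\tau)+\eta_{\Lambda_\tau}(\tau)}{f(\tau)+\eta_{\Lambda_\tau}(1)};\qquad \mathrm{Zeta}(\Gamma)\to Eq(\Gamma),\quad \mathcal{Z}\mapsto\frac{H_{[1,\tau]}(\tau)}{H_{[1,\tau]}(1)}.$$ These three maps are well defined, each of them is surjective, and the third map is the composition of the first followed by the second (the triangle commutes).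
   Context: $\mathbb{H}$ is the upper half-plane, $\gamma\tau=\frac{a\tau+b}{c\tau+d}$ for $\gamma=\begin{bmatrix}a&b\\c&d\end{bmatrix}$, $\Lambda_{(\omega_1,\omega_2)}=\omega_1\mathbb{Z}+\omega_2\mathbb{Z}$, and $\Lambda_\tau=\mathbb{Z}+\tau\mathbb{Z}$. Weierstrass zeta function: $\zeta(\Lambda,z)=\frac1z+\sum_{\omega\in\Lambda,\,\omega\ne0}\left(\frac{1}{z-\omega}+\frac1\omega+\frac{z}{\omega^2}\right)$; its quasi-period map $\eta_\Lambda:\Lambda\to\mathbb{C}$ is defined by $\zeta(\Lambda,z+\omega)=\zeta(\Lambda,z)+\eta_\Lambda(\omega)$. Modular forms and equivariant functions: $M_2(\Gamma)$ consists of the meromorphic functions $f$ on $\mathbb{H}$ with $f(\gamma\tau)=(c\tau+d)^2f(\tau)$ for all $\gamma=\begin{bmatrix}a&b\\c&d\end{bmatrix}\in\Gamma$. A $\Gamma$-equivariant function is a meromorphic function $h$ on $\mathbb{H}$ with $h(\gamma\tau)=\gamma h(\tau)$ for all $\gamma\in\Gamma$, $\tau\in\mathbb{H}$. Classes: let $\mathbb{M}=\{(\omega_1,\omega_2)\in\mathbb{C}^2:\Im(\omega_2/\omega_1)>0\}$. The group $\Gamma$ acts on $\mathbb{M}$ by $\gamma(\omega_1,\omega_2)=(\omega_1,\omega_2)\gamma^t=(a\omega_1+b\omega_2,\;c\omega_1+d\omega_2)$, where $\gamma^t$ is the transpose of $\gamma$. Put $\Omega_\Gamma=\Gamma\backslash\mathbb{M}$,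 write $[\omega_1,\omega_2]$ for the class of $(\omega_1,\omega_2)$, and let $\mathbb{C}^*$ act by $\alpha[\omega_1,\omega_2]=[\alpha\omega_1,\alpha\omega_2]$. A $\Gamma$-elliptic zeta function of weight $k\in\mathbb{Z}$ is a map $\mathcal{Z}:\Omega_\Gamma\times\mathbb{C}\to\mathbb{C}\cup\{\infty\}$ such that: (1) for each $[\omega_1,\omega_2]\in\Omega_\Gamma$, $\mathcal{Z}([\omega_1,\omega_2],\cdot)$ is quasi-periodic with respect to $\Lambda_{(\omega_1,\omega_2)}$: $\mathcal{Z}([\omega_1,\omega_2],z+\omega)=\mathcal{Z}([\omega_1,\omega_2],z)+H_{[\omega_1,\omega_2]}(\omega)$ for all $z\in\mathbb{C}$, $\omega\in\Lambda_{(\omega_1,\omega_2)}$, with $H_{[\omega_1,\omega_2]}(\omega)$ independent of $z$; (2) $\mathcal{Z}(\alpha[\omega_1,\omega_2],\alpha z)=\alpha^k\mathcal{Z}([\omega_1,\omega_2],z)$ for all $\alpha\in\mathbb{C}^*$, $[\omega_1,\omega_2]\in\Omega_\Gamma$, $z\in\mathbb{C}$; (3) $\tau\mapsto H_{[1,\tau]}(\tau)$ and $\tau\mapsto H_{[1,\tau]}(1)$ are meromorphic on $\mathbb{H}$. The maps $\Phi,\Psi$ attached to $\mathcal{Z}$ are the unique ones with $H_{[\omega_1,\omega_2]}(\omega)=\Phi_{[\omega_1,\omega_2]}\,\omega+\Psi_{[\omega_1,\omega_2]}\,\eta_{\Lambda_{(\omega_1,\omega_2)}}(\omega)$ for all $\omega\in\Lambda_{(\omega_1,\omega_2)}$;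 they exist and are unique because $\begin{bmatrix}\omega_2&\eta(\omega_2)\\ \omega_1&\eta(\omega_1)\end{bmatrix}$ (with $\eta=\eta_{\Lambda_{(\omega_1,\omega_2)}}$) is invertible.
   Formalization: The action of Γ on bases is taken as γ(ω1,ω2)=(dω1+cω2, bω1+aω2), so that the ratio ω2/ω1 transforms by γ; with the printed action the first map lands in M_2 of the conjugate of Γ under exchange of the coordinates, and the claim fails, e.g. for Γ_0(2). *)

theory Defs
  imports
    "HOL-Complex_Analysis.Complex_Analysis"
    "HOL-Algebra.Coset"
    "HOL-Library.FuncSet"
begin

section \<open>The modular group and its action on the upper half-plane\<close>

definition SL2Z :: "(int^2^2) monoid" where
  "SL2Z = \<lparr>carrier = {A. det A = 1}, mult = (**), one = mat 1\<rparr>"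

definition upper_half_plane :: "complex set"  (\<open>\<H>\<close>) where
  "\<H> = {\<tau>. Im \<tau> > 0}"

definition automorphy :: "int^2^2 \<Rightarrow> complex \<Rightarrow> complex" where
  "automorphy \<gamma> \<tau> = of_int (\<gamma>$2$1) * \<tau> + of_int (\<gamma>$2$2)"

definition moebius :: "int^2^2 \<Rightarrow> complex \<Rightarrow> complex" where
  "moebius \<gamma> \<tau> = (of_int (\<gamma>$1$1) * \<tau> + of_int (\<gamma>$1$2)) / automorphy \<gamma> \<tau>"

text \<open>\<^typ>\<open>complex option\<close> is the Riemann sphere, with \<^term>\<open>None\<close> as the point at infinity.\<close>

fun moebius_sphere :: "int^2^2 \<Rightarrow> complex option \<Rightarrow> complex option" where
  "moebius_sphere \<gamma> None =
     (if \<gamma>$2$1 = 0 then None else Some (of_int (\<gamma>$1$1) / of_int (\<gamma>$2$1)))"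
| "moebius_sphere \<gamma> (Some w) = (if automorphy \<gamma> w = 0 then None else Some (moebius \<gamma> w))"


section \<open>Meromorphic functions on the upper half-plane\<close>

text \<open>
  A meromorphic function on \<open>\<H>\<close> is represented by the unique
  \<^term>\<open>f \<in> extensional \<H>\<close> with \<^term>\<open>f nicely_meromorphic_on \<H>\<close>: removable singularities
  are filled in and the value 0 is stored at the poles. \<open>sphere_val f\<close> is the associated
  map to the Riemann sphere, and \<open>mero_of f\<close> turns a function that is meromorphic up to its
  values on a discrete set (such as a pointwise quotient) into this normal form.
\<close>

definition mero_of :: "(complex \<Rightarrow> complex) \<Rightarrow> complex \<Rightarrow> complex" where
  "mero_of f = restrict (remove_sings f) \<H>"

definition sphere_val :: "(complex \<Rightarrow> complex) \<Rightarrow> complex \<Rightarrow> complex option" where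
  "sphere_val f \<tau> = (if is_pole f \<tau> then None else Some (f \<tau>))"

text \<open>The pointwise condition below is also correct at the poles, where both sides are 0.\<close>

definition M2 :: "(int^2^2) set \<Rightarrow> (complex \<Rightarrow> complex) set" where
  "M2 \<Gamma> = {f \<in> extensional \<H>. f nicely_meromorphic_on \<H> \<and>
     (\<forall>\<gamma>\<in>\<Gamma>. \<forall>\<tau>\<in>\<H>. f (moebius \<gamma> \<tau>) = automorphy \<gamma> \<tau> ^ 2 * f \<tau>)}"

definition Eq :: "(int^2^2) set \<Rightarrow> (complex \<Rightarrow> complex) set" where
  "Eq \<Gamma> = {h \<in> extensional \<H>. h nicely_meromorphic_on \<H> \<and>
     (\<forall>\<gamma>\<in>\<Gamma>. \<forall>\<tau>\<in>\<H>. sphere_val h (moebius \<gamma> \<tau>) = moebius_sphere \<gamma> (sphere_val h \<tau>))}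
   - {restrict (\<lambda>\<tau>. \<tau>) \<H>}"


section \<open>Lattices and the Weierstrass zeta function\<close>

definition period_lattice :: "complex \<times> complex \<Rightarrow> complex set"  (\<open>\<Lambda>\<close>) where
  "\<Lambda> p = {of_int m * fst p + of_int n * snd p | m n. True}"

text \<open>At the lattice points themselves, which are poles, the value is irrelevant.\<close>

definition weierstrass_zeta :: "complex set \<Rightarrow> complex \<Rightarrow> complex" where
  "weierstrass_zeta L z =
     1 / z + (\<Sum>\<^sub>\<infinity>\<omega>\<in>L - {0}. 1 / (z - \<omega>) + 1 / \<omega> + z / \<omega>\<^sup>2)"

definition eta :: "complex set \<Rightarrow> complex \<Rightarrow> complex" where
  "eta L \<omega> = (THE e. \<forall>z. z \<notin> L \<longrightarrow> weierstrass_zeta L (z + \<omega>) = weierstrass_zeta L z + e)"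


section \<open>Classes of bases\<close>

definition bases :: "(complex \<times> complex) set" where
  "bases = {(\<omega>1, \<omega>2). Im (\<omega>2 / \<omega>1) > 0}"

text \<open>
  Since the ratio of a basis is \<open>\<omega>2 / \<omega>1\<close>, the matrix acts on the column with upper entry
  \<open>\<omega>2\<close> and lower entry \<open>\<omega>1\<close>, that is
  \<open>\<gamma> (\<omega>1, \<omega>2) = (c \<omega>2 + d \<omega>1, a \<omega>2 + b \<omega>1)\<close>. Thus the ratio \<open>\<tau>\<close> is sent to
  \<open>\<gamma> \<tau>\<close> and \<open>\<gamma> (1, \<tau>) = (c \<tau> + d) (1, \<gamma> \<tau>)\<close>. The formula
  \<open>(a \<omega>1 + b \<omega>2, c \<omega>1 + d \<omega>2)\<close> fits the opposite convention, with ratio \<open>\<omega>1 / \<omega>2\<close> and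
  classes of \<open>(\<tau>, 1)\<close>. Used with the classes of \<open>(1, \<tau>)\<close> it would produce modular forms
  for the conjugate of \<open>\<Gamma>\<close> under exchange of the two coordinates, for instance for
  \<open>\<Gamma>\<^sup>0(N)\<close> instead of \<open>\<Gamma>\<^sub>0(N)\<close>.
\<close>

fun basis_act :: "int^2^2 \<Rightarrow> complex \<times> complex \<Rightarrow> complex \<times> complex" where
  "basis_act \<gamma> (\<omega>1, \<omega>2) =
     (of_int (\<gamma>$2$1) * \<omega>2 + of_int (\<gamma>$2$2) * \<omega>1,
      of_int (\<gamma>$1$1) * \<omega>2 + of_int (\<gamma>$1$2) * \<omega>1)"

definition basis_class :: "(int^2^2) set \<Rightarrow> complex \<times> complex \<Rightarrow> (complex \<times> complex) set" where
  "basis_class \<Gamma> p = (\<lambda>\<gamma>. basis_act \<gamma> p) ` \<Gamma>"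

definition Omega :: "(int^2^2) set \<Rightarrow> (complex \<times> complex) set set"  (\<open>\<Omega>\<close>) where
  "\<Omega> \<Gamma> = basis_class \<Gamma> ` bases"

definition scale_class :: "complex \<Rightarrow> (complex \<times> complex) set \<Rightarrow> (complex \<times> complex) set" where
  "scale_class \<alpha> C = (\<lambda>(\<omega>1, \<omega>2). (\<alpha> * \<omega>1, \<alpha> * \<omega>2)) ` C"


section \<open>Elliptic zeta functions\<close>

type_synonym zeta_fun = "(complex \<times> complex) set \<Rightarrow> complex \<Rightarrow> complex option"

definition has_quasi_period :: "zeta_fun \<Rightarrow> (complex \<times> complex) set \<Rightarrow> complex \<Rightarrow> complex \<Rightarrow> bool" where
  "has_quasi_period Z C \<omega> h \<longleftrightarrow> (\<forall>z. Z C (z + \<omega>) = map_option (\<lambda>w. w + h) (Z C z))"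

text \<open>
  If \<open>Z C\<close> is identically infinite, then every number is a quasi-period and the quasi-period
  is undetermined. Such classes are the poles of the quasi-periods as functions of
  \<open>\<tau>\<close>: an infinite quasi-period forces \<open>Z C\<close> to be identically infinite. For every other
  class the quasi-period is unique and finite.
\<close>

definition polar_class :: "zeta_fun \<Rightarrow> (complex \<times> complex) set \<Rightarrow> bool" where
  "polar_class Z C \<longleftrightarrow> (\<forall>z. Z C z = None)"

definition quasi_period :: "zeta_fun \<Rightarrow> (complex \<times> complex) set \<Rightarrow> complex \<Rightarrow> complex" where
  "quasi_period Z C \<omega> = (THE h. has_quasi_period Z C \<omega> h)"

definition Phi_Psi :: "zeta_fun \<Rightarrow> (complex \<times> complex) set \<Rightarrow> complex \<times> complex" where
  "Phi_Psi Z C = (THE (\<phi>, \<psi>). \<forall>p\<in>C. \<forall>\<omega>\<in>\<Lambda> p.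
     quasi_period Z C \<omega> = \<phi> * \<omega> + \<psi> * eta (\<Lambda> p) \<omega>)"

definition Phi :: "zeta_fun \<Rightarrow> (complex \<times> complex) set \<Rightarrow> complex" where
  "Phi Z C = fst (Phi_Psi Z C)"

definition Psi :: "zeta_fun \<Rightarrow> (complex \<times> complex) set \<Rightarrow> complex" where
  "Psi Z C = snd (Phi_Psi Z C)"

text \<open>
  Here \<open>S\<close> is the set of points where the function under consideration is infinite or
  undetermined; \<^term>\<open>f meromorphic_on A\<close> does not depend on the values of \<open>f\<close> there.
\<close>

definition meromorphic_off :: "(complex \<Rightarrow> complex) \<Rightarrow> complex set \<Rightarrow> complex set \<Rightarrow> bool" where
  "meromorphic_off f S A \<longleftrightarrow> S sparse_in A \<and> f holomorphic_on (A - S) \<and> f meromorphic_on A"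

definition elliptic_zeta :: "(int^2^2) set \<Rightarrow> int \<Rightarrow> zeta_fun \<Rightarrow> bool" where
  "elliptic_zeta \<Gamma> k Z \<longleftrightarrow>
     Z \<in> extensional (\<Omega> \<Gamma>) \<and>
     (\<forall>p\<in>bases. \<forall>\<omega>\<in>\<Lambda> p. \<exists>h. has_quasi_period Z (basis_class \<Gamma> p) \<omega> h) \<and>
     (\<forall>\<alpha> C z. \<alpha> \<noteq> 0 \<longrightarrow> C \<in> \<Omega> \<Gamma> \<longrightarrow>
        Z (scale_class \<alpha> C) (\<alpha> * z) = map_option (\<lambda>w. \<alpha> powi k * w) (Z C z)) \<and>
     (let S = {\<tau>\<in>\<H>. polar_class Z (basis_class \<Gamma> (1, \<tau>))} in
        meromorphic_off (\<lambda>\<tau>. quasi_period Z (basis_class \<Gamma> (1, \<tau>)) \<tau>) S \<H> \<and>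
        meromorphic_off (\<lambda>\<tau>. quasi_period Z (basis_class \<Gamma> (1, \<tau>)) 1) S \<H>)"

definition Zeta :: "(int^2^2) set \<Rightarrow> zeta_fun set" where
  "Zeta \<Gamma> = {Z. (\<exists>k. elliptic_zeta \<Gamma> k Z) \<and>
     (\<exists>\<tau>\<in>\<H>. \<not> polar_class Z (basis_class \<Gamma> (1, \<tau>)) \<and> Psi Z (basis_class \<Gamma> (1, \<tau>)) \<noteq> 0)}"


section \<open>The three maps\<close>

definition Zeta_to_M2 :: "(int^2^2) set \<Rightarrow> zeta_fun \<Rightarrow> complex \<Rightarrow> complex" where
  "Zeta_to_M2 \<Gamma> Z =
     mero_of (\<lambda>\<tau>. Phi Z (basis_class \<Gamma> (1, \<tau>)) / Psi Z (basis_class \<Gamma> (1, \<tau>)))"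

definition M2_to_Eq :: "(complex \<Rightarrow> complex) \<Rightarrow> complex \<Rightarrow> complex" where
  "M2_to_Eq f =
     mero_of (\<lambda>\<tau>. (\<tau> * f \<tau> + eta (\<Lambda> (1, \<tau>)) \<tau>) / (f \<tau> + eta (\<Lambda> (1, \<tau>)) 1))"

definition Zeta_to_Eq :: "(int^2^2) set \<Rightarrow> zeta_fun \<Rightarrow> complex \<Rightarrow> complex" where
  "Zeta_to_Eq \<Gamma> Z =
     mero_of (\<lambda>\<tau>. quasi_period Z (basis_class \<Gamma> (1, \<tau>)) \<tau> / quasi_period Z (basis_class \<Gamma> (1, \<tau>)) 1)"

end

theory Submission
  imports Defs
begin

text \<open>
  Write \<open>\<eta>\<^sub>1, \<eta>\<^sub>2\<close> for the quasi-periods of \<open>\<zeta>(\<Lambda>\<^sub>\<tau>, \<cdot>)\<close> at \<open>1, \<tau>\<close>, and \<open>H\<^sub>1, H\<^sub>2\<close> for those of an elliptic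
  zeta function of weight \<open>k\<close>. Both \<open>(\<eta>\<^sub>2, \<eta>\<^sub>1)\<close> and \<open>(H\<^sub>2, H\<^sub>1)\<close> transform as vectors under \<open>\<gamma>\<close>, up to the
  factors \<open>c \<tau> + d\<close> and \<open>(c \<tau> + d)\<^sup>-\<^sup>k\<close>. Hence \<open>W = \<eta>\<^sub>2 - \<tau> \<eta>\<^sub>1\<close> is invariant (Legendre: it is constant; only
  \<open>W \<noteq> 0\<close> is needed) and \<open>\<Phi> / \<Psi> = (H\<^sub>2 \<eta>\<^sub>1 - H\<^sub>1 \<eta>\<^sub>2) / (\<tau> H\<^sub>1 - H\<^sub>2)\<close> has weight 2. The map from forms to equivariant
  functions is \<open>h = \<tau> + W / (f + \<eta>\<^sub>1)\<close>, with inverse \<open>f = W / (h - \<tau>) - \<eta>\<^sub>1\<close>. Finite index enters only to find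
  \<open>\<gamma>\<close> with \<open>c \<noteq> 0\<close>, which excludes \<open>f = -\<eta>\<^sub>1\<close>. A preimage of \<open>f\<close> under the first map is
  \<open>\<omega>\<^sub>1\<^sup>-\<^sup>2 f(\<omega>\<^sub>2 / \<omega>\<^sub>1) z + \<zeta>(\<Lambda>, z)\<close>, of weight \<open>-1\<close>.
\<close>

section \<open>Convergence and quasi-periodicity of the zeta function\<close>

text \<open>The formula for h is forced by linear algebra: (\<tau> f + \<open>eta2\<close>, f +
  \<open>eta1\<close>) is the sum of f (\<tau>, 1) and (\<open>eta2\<close>, \<open>eta1\<close>).
  Under \<gamma> the vector (\<tau>, 1) picks up (c \<tau> + d)^-1 and the second vector c \<tau> +
  d, so weight 2 is exactly what lets f (\<tau>, 1) transform like its partner; the quotient of the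
  two components is then equivariant. Analysis enters through \<open>eta1\<close> and
  \<open>eta2\<close>, which must be constants in z, holomorphic in \<tau>, and independent of
  (\<tau>, 1). The majorant of the lattice sum therefore has to be uniform in \<tau> as well as in
  z, and its constants are kept explicit. The other obstacle is poles and the conventional values
  stored there. Identities are proved only on punctured neighbourhoods, where poles and vanishing
  denominators can be avoided, and carried to every point by uniqueness of limits in the Riemann
  sphere. By the identity theorem a denominator such as f + \<open>eta1\<close> or h - \<tau> needs
  just one reason not to vanish identically.\<close>

definition lattice_point :: "complex \<Rightarrow> int \<times> int \<Rightarrow> complex" where
  "lattice_point t = (\<lambda>(m, n). of_int m + of_int n * t)"

text \<open>A product, so that summability over pairs reduces to one variable. The exponent 3/2
  exceeds 1 and is half of the cubic decay of a zeta summand, which fits (1 + |m|)(1 + |n|) \<le> (1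
  + |m| + |n|)^2.\<close>

definition lattice_weight :: "int \<times> int \<Rightarrow> real" where
  "lattice_weight = (\<lambda>(m, n). (1 + \<bar>of_int m\<bar>) powr (-3/2) * (1 + \<bar>of_int n\<bar>) powr (-3/2))"

lemma summable_on_int_powr:
  "(\<lambda>m::int. (1 + \<bar>of_int m\<bar> :: real) powr (-3/2)) summable_on UNIV" (is "?v summable_on _")
proof -
  have "summable (\<lambda>n. real (Suc n) powr (-3/2))"
    by (subst summable_Suc_iff) (simp add: summable_real_powr_iff)
  then have nat: "(\<lambda>n::nat. (1 + real n) powr (-3/2)) summable_on UNIV"
    by (intro norm_summable_imp_summable_on) (simp add: add.commute)
  have "?v summable_on range int"
    by (subst summable_on_reindex) (use nat in \<open>auto simp: o_def inj_on_def\<close>)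
  moreover have "?v summable_on range (\<lambda>n. - int n)"
    by (subst summable_on_reindex) (use nat in \<open>auto simp: o_def inj_on_def\<close>)
  ultimately have "?v summable_on (range int \<union> range (\<lambda>n. - int n))"
    by (rule summable_on_union)
  moreover have "range int \<union> range (\<lambda>n. - int n) = UNIV"
    by (auto simp: image_iff) (metis int_cases2)
  ultimately show ?thesis by simp
qed

lemma summable_lattice_weight: "lattice_weight summable_on A"
proof -
  let ?v = "\<lambda>m::int. (1 + \<bar>of_int m\<bar> :: real) powr (-3/2)"
  have "lattice_weight summable_on Sigma UNIV (\<lambda>_. UNIV)"
  proof (rule summable_on_SigmaI)
    show "((\<lambda>n. lattice_weight (m, n)) has_sum (?v m * infsum ?v UNIV)) UNIV" for m
      unfolding lattice_weight_def using summable_on_int_powr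
      by (auto intro!: has_sum_cmult_right has_sum_infsum)
    show "(\<lambda>m. ?v m * infsum ?v UNIV) summable_on UNIV"
      by (intro summable_on_cmult_left summable_on_int_powr)
  qed (auto simp: lattice_weight_def)
  then show ?thesis
    using summable_on_subset_banach by force
qed

lemma lattice_weight_ge:
  "1 / (1 + (\<bar>of_int m\<bar> + \<bar>of_int n\<bar>)) ^ 3 \<le> lattice_weight (m, n)"
proof -
  define N :: real where "N = 1 + (\<bar>of_int m\<bar> + \<bar>of_int n\<bar>)"
  have N: "N \<ge> 1" by (simp add: N_def)
  have "(1 + \<bar>of_int m\<bar>) * (1 + \<bar>of_int n\<bar>) \<le> N\<^sup>2"
    by (auto simp: N_def power2_eq_square algebra_simps)
  then have "(N\<^sup>2) powr (-3/2) \<le> ((1 + \<bar>of_int m\<bar>) * (1 + \<bar>of_int n\<bar>)) powr (-3/2)"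
    by (intro powr_mono2') (auto intro!: mult_pos_pos add_pos_nonneg)
  also have "(N\<^sup>2) powr (-3/2) = N powr (-3)"
    using N by (simp add: powr_powr flip: powr_numeral)
  also have "\<dots> = 1 / N ^ 3"
    using N by (simp add: powr_minus powr_numeral divide_simps)
  finally show ?thesis
    by (simp add: lattice_weight_def powr_mult N_def)
qed

text \<open>Taking imaginary parts bounds y; subtracting y t then bounds x. The constant is explicit
  because it must be dominated by one number while t ranges over a neighbourhood.\<close>

lemma real_coordinates_le:
  assumes t: "Im t > 0"
  shows "\<bar>x\<bar> + \<bar>y\<bar> \<le> (1 + (1 + norm t) / Im t) * norm (of_real x + of_real y * t)"
proof -
  let ?w = "of_real x + of_real y * t"
  have "\<bar>Im ?w\<bar> \<le> norm ?w" by (rule abs_Im_le_cmod)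
  then have y: "\<bar>y\<bar> \<le> norm ?w / Im t"
    using t by (simp add: abs_mult field_simps)
  have "\<bar>x\<bar> = norm (?w - of_real y * t)" by simp
  also have "\<dots> \<le> norm ?w + \<bar>y\<bar> * norm t"
    by (metis norm_mult norm_of_real norm_triangle_ineq4)
  finally have "\<bar>x\<bar> + \<bar>y\<bar> \<le> norm ?w + \<bar>y\<bar> * (1 + norm t)" by (simp add: algebra_simps)
  also have "\<dots> \<le> norm ?w + norm ?w / Im t * (1 + norm t)"
    using y by (intro add_left_mono mult_right_mono) auto
  finally show ?thesis by (simp add: algebra_simps)
qed

lemma real_coordinates_exist:
  assumes "Im t > 0"
  obtains x y where "z = of_real x + of_real y * t"
proof
  show "z = of_real (Re z - Im z / Im t * Re t) + of_real (Im z / Im t) * t"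
    using assms by (auto simp: complex_eq_iff field_simps)
qed

lemma real_coordinates_eq_0:
  assumes "Im t > 0" "of_real x + of_real y * t = 0"
  shows "x = 0" "y = 0"
  using real_coordinates_le[OF assms(1), of x y] assms(2) by auto

text \<open>The three fractions combine to z^2 / (w^2 (z - w)), of cubic decay. B and C are upper
  bounds rather than exact values, and E measures the separation of z from the lattice relative to
  the size of (m, n), so that a single majorant serves a whole neighbourhood of z or of t.\<close>

lemma zeta_term_bound:
  fixes a b :: real
  assumes t: "Im t > 0" and C: "1 + (1 + norm t) / Im t \<le> C"
    and z: "z = of_real a + of_real b * t" "norm z \<le> B"
    and E: "1 + (\<bar>of_int m\<bar> + \<bar>of_int n\<bar>) \<le> E * (\<bar>a - of_int m\<bar> + \<bar>b - of_int n\<bar>)" "E \<ge> 0"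
    and mn: "(m, n) \<noteq> (0, 0)" and w: "w = lattice_point t (m, n)"
  shows "z - w \<noteq> 0" "w \<noteq> 0"
    "norm (1 / (z - w) + 1 / w + z / w\<^sup>2) \<le> 4 * B\<^sup>2 * C ^ 3 * E * lattice_weight (m, n)"
proof -
  define N :: real where "N = \<bar>of_int m\<bar> + \<bar>of_int n\<bar>"
  have N: "N \<ge> 1" using mn by (auto simp: N_def)
  have C1: "C \<ge> 1" using C t by (smt (verit) divide_nonneg_pos norm_ge_zero)
  have "N \<le> (1 + (1 + norm t) / Im t) * norm w"
    using real_coordinates_le[OF t, of "of_int m" "of_int n"] by (simp add: w lattice_point_def N_def)
  also have "\<dots> \<le> C * norm w" using C by (intro mult_right_mono) auto
  finally have w1: "N \<le> C * norm w" .
  \<comment> \<open>Since N \<ge> 1, the extra 1 costs a factor 2; squared, it is the 4 in the final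
    bound.\<close>
  then have w2: "1 + N \<le> 2 * C * norm w" using N by linarith
  have zw: "z - w = of_real (a - of_int m) + of_real (b - of_int n) * t"
    by (simp add: z w lattice_point_def algebra_simps)
  have "1 + N \<le> E * (\<bar>a - of_int m\<bar> + \<bar>b - of_int n\<bar>)"
    using E by (simp add: N_def)
  also have "\<dots> \<le> E * ((1 + (1 + norm t) / Im t) * norm (z - w))"
    unfolding zw using E(2) by (intro mult_left_mono real_coordinates_le[OF t])
  also have "\<dots> \<le> E * (C * norm (z - w))"
    using C E by (intro mult_left_mono mult_right_mono) auto
  finally have z2: "1 + N \<le> E * C * norm (z - w)" by simp
  show nz: "z - w \<noteq> 0" "w \<noteq> 0" using z2 w2 N by auto
  have B: "B \<ge> 0" using z norm_ge_zero order_trans by blast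
  have "1 / (z - w) + 1 / w + z / w\<^sup>2 = z\<^sup>2 / (w\<^sup>2 * (z - w))"
    using nz by (simp add: field_simps power2_eq_square)
  then have eq: "norm (1 / (z - w) + 1 / w + z / w\<^sup>2) = (norm z)\<^sup>2 / ((norm w)\<^sup>2 * norm (z - w))"
    by (simp add: norm_divide norm_mult norm_power)
  have "(1 + N) ^ 3 = (1 + N)\<^sup>2 * (1 + N)" by (simp add: power3_eq_cube power2_eq_square)
  also have "\<dots> \<le> (2 * C * norm w)\<^sup>2 * (E * C * norm (z - w))"
    using w2 z2 N by (intro mult_mono power_mono) auto
  also have "\<dots> = 4 * C ^ 3 * E * ((norm w)\<^sup>2 * norm (z - w))"
    by (simp add: power_mult_distrib power3_eq_cube power2_eq_square)
  finally have key: "(1 + N) ^ 3 \<le> 4 * C ^ 3 * E * ((norm w)\<^sup>2 * norm (z - w))" .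
  have "1 / ((norm w)\<^sup>2 * norm (z - w)) \<le> 4 * C ^ 3 * E * (1 / (1 + N) ^ 3)"
    using key nz N by (simp add: field_simps)
  also have "\<dots> \<le> 4 * C ^ 3 * E * lattice_weight (m, n)"
    using lattice_weight_ge[of m n] C1 E by (intro mult_left_mono) (auto simp: N_def)
  finally have "(norm z)\<^sup>2 * (1 / ((norm w)\<^sup>2 * norm (z - w))) \<le> B\<^sup>2 * (4 * C ^ 3 * E * lattice_weight (m, n))"
    using z B by (intro mult_mono power_mono) auto
  then show "norm (1 / (z - w) + 1 / w + z / w\<^sup>2) \<le> 4 * B\<^sup>2 * C ^ 3 * E * lattice_weight (m, n)"
    unfolding eq by (simp add: mult_ac)
qed

text \<open>Supplies E for \<open>zeta_term_bound\<close> from an absolute distance d: if X is the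
  distance from (a, b) to (x, y), then |x| + |y| \<le> X + r and 1 \<le> X / d.\<close>

lemma coordinate_distance_bound:
  fixes a b x y :: real
  assumes "d > 0" "d \<le> \<bar>a - x\<bar> + \<bar>b - y\<bar>" "\<bar>a\<bar> + \<bar>b\<bar> \<le> r"
  shows "1 + (\<bar>x\<bar> + \<bar>y\<bar>) \<le> (1 + (r + 1) / d) * (\<bar>a - x\<bar> + \<bar>b - y\<bar>)"
proof -
  define X where "X = \<bar>a - x\<bar> + \<bar>b - y\<bar>"
  have X: "1 \<le> X / d" using assms by (simp add: X_def)
  have r: "r \<ge> 0" using assms by linarith
  have "\<bar>x\<bar> \<le> \<bar>a\<bar> + \<bar>a - x\<bar>" "\<bar>y\<bar> \<le> \<bar>b\<bar> + \<bar>b - y\<bar>" by linarith+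
  then have "1 + (\<bar>x\<bar> + \<bar>y\<bar>) \<le> X + (r + 1) * 1" using assms(3) by (simp add: X_def)
  also have "\<dots> \<le> X + (r + 1) * (X / d)" using X r by (intro add_left_mono mult_left_mono) auto
  also have "\<dots> = (1 + (r + 1) / d) * X" by (simp add: algebra_simps)
  finally show ?thesis by (simp only: X_def)
qed

lemma noninteger_distance:
  assumes "a \<notin> \<int>"
  obtains d :: real where "d > 0" "\<And>m::int. d \<le> \<bar>a - of_int m\<bar>"
proof
  have "frac a > 0" "frac a < 1" using assms by (auto simp: frac_gt_0_iff frac_lt_1)
  then show "min (frac a) (1 - frac a) > 0" by simp
  show "min (frac a) (1 - frac a) \<le> \<bar>a - of_int m\<bar>" for m
  proof (cases "m \<le> \<lfloor>a\<rfloor>")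
    case True
    then have "real_of_int m \<le> of_int \<lfloor>a\<rfloor>" by simp
    then show ?thesis unfolding frac_def by linarith
  next
    case False
    then have "real_of_int m \<ge> of_int \<lfloor>a\<rfloor> + 1" by linarith
    then show ?thesis unfolding frac_def by linarith
  qed
qed

lemma nonlattice_distance:
  assumes "a \<notin> \<int> \<or> b \<notin> \<int>"
  obtains d :: real where "d > 0" "\<And>m n::int. d \<le> \<bar>a - of_int m\<bar> + \<bar>b - of_int n\<bar>"
  using assms
proof
  assume "a \<notin> \<int>"
  then obtain d where "d > 0" "\<And>m::int. d \<le> \<bar>a - of_int m\<bar>" using noninteger_distance by blast
  then show thesis by (intro that[of d]) (auto intro: add_increasing2)
next
  assume "b \<notin> \<int>"
  then obtain d where "d > 0" "\<And>m::int. d \<le> \<bar>b - of_int m\<bar>" using noninteger_distance by blast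
  then show thesis by (intro that[of d]) (auto intro: add_increasing)
qed

lemma inj_lattice_point:
  assumes "Im t > 0"
  shows "inj (lattice_point t)"
proof (rule injI)
  fix p q assume eq: "lattice_point t p = lattice_point t q"
  obtain a b c d where pq: "p = (a, b)" "q = (c, d)" by (cases p, cases q)
  have "of_real (of_int (a - c)) + of_real (of_int (b - d)) * t = 0"
    using eq by (simp add: pq lattice_point_def algebra_simps)
  from real_coordinates_eq_0[OF assms this] show "p = q" by (simp add: pq)
qed

lemma period_lattice_range: "\<Lambda> (1, t) = range (lattice_point t)"
  by (auto simp: period_lattice_def lattice_point_def image_iff)

lemma lattice_point_0 [simp]: "lattice_point t (0, 0) = 0"
  by (simp add: lattice_point_def)

text \<open>The part of zeta without the pole at 0. Summing over pairs of integers instead of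
  lattice points keeps the index set fixed while t varies, so holomorphy can be checked termwise in
  t as well as in z.\<close>

definition zeta_regular :: "complex \<Rightarrow> complex \<Rightarrow> complex" where
  "zeta_regular t z = (\<Sum>\<^sub>\<infinity>mn\<in>-{(0, 0)}.
     1 / (z - lattice_point t mn) + 1 / lattice_point t mn + z / (lattice_point t mn)\<^sup>2)"

lemma weierstrass_zeta_eq_regular:
  assumes t: "Im t > 0"
  shows "weierstrass_zeta (\<Lambda> (1, t)) z = 1 / z + zeta_regular t z"
proof -
  have inj: "inj_on (lattice_point t) A" for A
    using inj_lattice_point[OF t] by (rule inj_on_subset) auto
  have "lattice_point t ` (UNIV - {(0, 0)}) = range (lattice_point t) - {0}"
    by (subst image_set_diff[OF inj]) simp
  then have "\<Lambda> (1, t) - {0} = lattice_point t ` (-{(0, 0)})"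
    by (simp add: period_lattice_range Compl_eq_Diff_UNIV)
  then show ?thesis
    by (simp add: weierstrass_zeta_def zeta_regular_def infsum_reindex[OF inj] o_def)
qed

lemma infsum_difference:
  fixes f g :: "'a \<Rightarrow> complex"
  assumes "f summable_on A" "g summable_on A"
  shows "(\<lambda>x. f x - g x) summable_on A" "(\<Sum>\<^sub>\<infinity>x\<in>A. f x - g x) = infsum f A - infsum g A"
  using summable_on_add[OF assms(1), of "\<lambda>x. - g x"] infsum_add[OF assms(1), of "\<lambda>x. - g x"] assms(2)
  by (simp_all add: summable_on_uminus infsum_uminus)

text \<open>The M-test gives uniform convergence along finite subsets, and a uniform limit of
  holomorphic functions is holomorphic on each ball whose closure lies in U.\<close>

lemma holomorphic_infsum:
  assumes "open U"
    and "\<And>x. x \<in> X \<Longrightarrow> f x holomorphic_on U"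
    and "\<And>x z. x \<in> X \<Longrightarrow> z \<in> U \<Longrightarrow> norm (f x z) \<le> M x" "M summable_on X"
  shows "(\<lambda>z. \<Sum>\<^sub>\<infinity>x\<in>X. f x z) holomorphic_on U"

proof -
  have lim: "uniform_limit U (\<lambda>Y z. \<Sum>x\<in>Y. f x z) (\<lambda>z. \<Sum>\<^sub>\<infinity>x\<in>X. f x z) (finite_subsets_at_top X)"
    using assms(3,4) by (rule Weierstrass_m_test_general)
  have hol: "\<forall>\<^sub>F Y in finite_subsets_at_top X. (\<lambda>z. \<Sum>x\<in>Y. f x z) holomorphic_on U"
    by (intro eventually_finite_subsets_at_top_weakI holomorphic_on_sum assms(2)) auto
  have "(\<lambda>z. \<Sum>\<^sub>\<infinity>x\<in>X. f x z) analytic_on U"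
    unfolding analytic_on_def
  proof
    fix z assume "z \<in> U"
    then obtain r where r: "r > 0" "cball z r \<subseteq> U"
      using assms(1) by (meson open_contains_cball)
    have "\<forall>\<^sub>F Y in finite_subsets_at_top X. continuous_on (cball z r) (\<lambda>z. \<Sum>x\<in>Y. f x z) \<and>
        (\<lambda>z. \<Sum>x\<in>Y. f x z) holomorphic_on ball z r"
      using hol
    proof eventually_elim
      case (elim Y)
      then show ?case
        using r(2) ball_subset_cball[of z r]
        by (meson holomorphic_on_imp_continuous_on holomorphic_on_subset)
    qed
    then have "(\<lambda>z. \<Sum>\<^sub>\<infinity>x\<in>X. f x z) holomorphic_on ball z r"
      by (rule holomorphic_uniform_limit[OF _ uniform_limit_on_subset[OF lim r(2)]]) auto
    then show "\<exists>e>0. (\<lambda>z. \<Sum>\<^sub>\<infinity>x\<in>X. f x z) holomorphic_on ball z e"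
      using r(1) by blast
  qed
  then show ?thesis by (rule analytic_imp_holomorphic)
qed

text \<open>
  Since \<open>1 / 0 = 0\<close>, the summand at \<open>\<omega> = 0\<close> is \<open>1 / z\<close>, so \<open>\<zeta>\<close> is one sum over the whole lattice.
\<close>
lemma zeta_terms_summable:
  assumes t: "Im t > 0" and z: "z \<notin> \<Lambda> (1, t)"
  shows "(\<lambda>mn. 1 / (z - lattice_point t mn) + 1 / lattice_point t mn + z / (lattice_point t mn)\<^sup>2)
           summable_on UNIV" (is "?f summable_on _")
proof -
  obtain a b where ab: "z = of_real a + of_real b * t"
    using real_coordinates_exist[OF t] .
  have "a \<notin> \<int> \<or> b \<notin> \<int>"
  proof (rule ccontr)
    assume "\<not> ?thesis"
    then obtain m n where "a = of_int m" "b = of_int n" by (auto elim!: Ints_cases)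
    then have "z = lattice_point t (m, n)" by (simp add: ab lattice_point_def)
    then show False using z by (simp add: period_lattice_range)
  qed
  then obtain d where d: "d > 0" "\<And>m n::int. d \<le> \<bar>a - of_int m\<bar> + \<bar>b - of_int n\<bar>"
    using nonlattice_distance by blast
  define E where "E = 1 + ((\<bar>a\<bar> + \<bar>b\<bar>) + 1) / d"
  define C where "C = 1 + (1 + norm t) / Im t"
  have E: "E \<ge> 0" using d(1) by (auto simp: E_def intro!: add_nonneg_nonneg)
  have "norm (?f mn) \<le> 4 * (norm z)\<^sup>2 * C ^ 3 * E * lattice_weight mn" if "mn \<in> -{(0, 0)}" for mn
  proof -
    obtain m n where [simp]: "mn = (m, n)" by (cases mn)
    show ?thesis
      using zeta_term_bound(3)[OF t _ ab order_refl _ E _ refl, of C m n]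
        coordinate_distance_bound[OF d, of "\<bar>a\<bar> + \<bar>b\<bar>" m n] that
      by (simp add: E_def C_def)
  qed
  note bound = this
  have "(\<lambda>mn. 4 * (norm z)\<^sup>2 * C ^ 3 * E * lattice_weight mn) summable_on -{(0, 0)}"
    by (intro summable_on_cmult_right summable_lattice_weight)
  then have "(\<lambda>mn. norm (?f mn)) summable_on -{(0, 0)}"
    using bound by (rule Infinite_Sum.abs_summable_on_comparison_test')
  then have "?f summable_on -{(0, 0)}"
    by (rule abs_summable_summable)
  then have "?f summable_on ({(0, 0)} \<union> -{(0, 0)})"
    by (intro summable_on_union) simp_all
  then show ?thesis by simp
qed

lemma weierstrass_zeta_eq_infsum:
  assumes t: "Im t > 0" and z: "z \<notin> \<Lambda> (1, t)"
  shows "weierstrass_zeta (\<Lambda> (1, t)) z =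
    (\<Sum>\<^sub>\<infinity>mn. 1 / (z - lattice_point t mn) + 1 / lattice_point t mn + z / (lattice_point t mn)\<^sup>2)"
    (is "_ = infsum ?f _")
proof -
  have "?f summable_on -{(0, 0)}"
    using zeta_terms_summable[OF assms] by (rule summable_on_subset_banach) auto
  then have "infsum ?f (insert (0, 0) (-{(0, 0)})) = ?f (0, 0) + infsum ?f (-{(0, 0)})"
    by (subst infsum_insert) auto
  moreover have "insert (0, 0) (-{(0, 0)}) = (UNIV :: (int \<times> int) set)" by auto
  ultimately show ?thesis
    by (simp add: weierstrass_zeta_eq_regular[OF t] zeta_regular_def)
qed

lemma period_lattice_add:
  assumes "x \<in> \<Lambda> p" "y \<in> \<Lambda> p" shows "x + y \<in> \<Lambda> p"
proof -
  obtain a b c d where "x = of_int a * fst p + of_int b * snd p" "y = of_int c * fst p + of_int d * snd p"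
    using assms by (auto simp: period_lattice_def)
  then have "x + y = of_int (a + c) * fst p + of_int (b + d) * snd p" by (simp add: algebra_simps)
  then show ?thesis unfolding period_lattice_def by blast
qed

lemma period_lattice_uminus:
  assumes "x \<in> \<Lambda> p" shows "- x \<in> \<Lambda> p"
proof -
  obtain a b where "x = of_int a * fst p + of_int b * snd p"
    using assms by (auto simp: period_lattice_def)
  then have "- x = of_int (- a) * fst p + of_int (- b) * snd p" by simp
  then show ?thesis unfolding period_lattice_def by blast
qed

lemma period_lattice_add_iff:
  assumes "\<omega> \<in> \<Lambda> p" shows "z + \<omega> \<in> \<Lambda> p \<longleftrightarrow> z \<in> \<Lambda> p"
  using assms period_lattice_add[of "z + \<omega>" p "- \<omega>"] period_lattice_add[of z p \<omega>]
    period_lattice_uminus[of \<omega> p] by auto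

lemma bij_int_pair_shift: "bij (\<lambda>(m::int, n::int). (m + a, n + b))"
  by (rule bij_betw_byWitness[where f' = "\<lambda>(m, n). (m - a, n - b)"]) auto

text \<open>
  The second difference of \<open>\<zeta>\<close> in \<open>z\<close> and \<open>\<omega>\<close> is \<open>(z - w)\<close> times a sum over the lattice that is odd
  under \<open>x \<mapsto> - x - \<omega>\<close>; this avoids the detour through \<open>\<wp>\<close> and its derivative.
\<close>
lemma weierstrass_zeta_second_difference:
  assumes t: "Im t > 0" and z: "z \<notin> \<Lambda> (1, t)" "w \<notin> \<Lambda> (1, t)" and \<omega>: "\<omega> \<in> \<Lambda> (1, t)"
  shows "weierstrass_zeta (\<Lambda> (1, t)) (z + \<omega>) - weierstrass_zeta (\<Lambda> (1, t)) z =
         weierstrass_zeta (\<Lambda> (1, t)) (w + \<omega>) - weierstrass_zeta (\<Lambda> (1, t)) w"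
proof -
  define f where "f = (\<lambda>z mn. 1 / (z - lattice_point t mn) + 1 / lattice_point t mn
    + z / (lattice_point t mn)\<^sup>2)"
  define g where "g = (\<lambda>z w mn. 1 / (z - lattice_point t mn) - 1 / (w - lattice_point t mn)
    + (z - w) / (lattice_point t mn)\<^sup>2)"
  have fsum: "f z summable_on UNIV" if "z \<notin> \<Lambda> (1, t)" for z
    using zeta_terms_summable[OF t that] by (simp add: f_def)
  have zeta_f: "weierstrass_zeta (\<Lambda> (1, t)) z = infsum (f z) UNIV" if "z \<notin> \<Lambda> (1, t)" for z
    unfolding f_def by (rule weierstrass_zeta_eq_infsum[OF t that])
  have fg: "f z mn - f w mn = g z w mn" for z w mn
    by (simp add: f_def g_def diff_divide_distrib)
  have gsum: "g z w summable_on UNIV" if "z \<notin> \<Lambda> (1, t)" "w \<notin> \<Lambda> (1, t)" for z w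
    using infsum_difference(1)[OF fsum fsum, OF that] by (simp add: fg)
  have zeta_diff: "weierstrass_zeta (\<Lambda> (1, t)) z - weierstrass_zeta (\<Lambda> (1, t)) w = infsum (g z w) UNIV"
    if "z \<notin> \<Lambda> (1, t)" "w \<notin> \<Lambda> (1, t)" for z w
    using infsum_difference(2)[OF fsum fsum, OF that]
    by (simp add: zeta_f that fg)
  obtain a b where ab: "\<omega> = lattice_point t (a, b)"
    using \<omega> by (auto simp: period_lattice_range)
  define s where "s = (\<lambda>(m::int, n::int). (m + a, n + b))"
  have s: "bij s" unfolding s_def by (rule bij_int_pair_shift)
  have lp_s: "lattice_point t (s mn) = lattice_point t mn + \<omega>" for mn
    by (cases mn) (simp add: s_def ab lattice_point_def algebra_simps)
  \<comment> \<open>After the shift of indices by \<open>s\<close> the fractions with z and w in the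
    denominator cancel; only the quadratic corrections survive, with the common factor z -
    w.\<close>
  define k where "k = (\<lambda>mn. 1 / (lattice_point t mn + \<omega>)\<^sup>2 - 1 / (lattice_point t mn)\<^sup>2)"
  have shifted: "z + \<omega> \<notin> \<Lambda> (1, t)" "w + \<omega> \<notin> \<Lambda> (1, t)"
    using z period_lattice_add_iff[OF \<omega>] by auto
  have "(\<lambda>mn. g (z + \<omega>) (w + \<omega>) (s mn)) summable_on UNIV"
    using gsum[OF shifted] s by (subst summable_on_reindex_bij_betw) auto
  moreover have "infsum (g (z + \<omega>) (w + \<omega>)) UNIV = (\<Sum>\<^sub>\<infinity>mn. g (z + \<omega>) (w + \<omega>) (s mn))"
    using s by (subst infsum_reindex_bij_betw) auto
  ultimately have "infsum (g (z + \<omega>) (w + \<omega>)) UNIV - infsum (g z w) UNIV =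
      (\<Sum>\<^sub>\<infinity>mn. g (z + \<omega>) (w + \<omega>) (s mn) - g z w mn)"
    using infsum_difference(2)[OF _ gsum[OF z]] by simp
  also have "\<dots> = (\<Sum>\<^sub>\<infinity>mn. (z - w) * k mn)"
    by (intro infsum_cong) (simp add: g_def k_def lp_s algebra_simps diff_divide_distrib add_divide_distrib)
  also have "\<dots> = (z - w) * infsum k UNIV"
    by (rule infsum_cmult_right')
  also have "infsum k UNIV = 0"
  proof -
    have bij: "bij (\<lambda>(m::int, n::int). (- m - a, - n - b))"
      by (rule bij_betw_byWitness[where f' = "\<lambda>(m, n). (- m - a, - n - b)"]) auto
    have "infsum k UNIV = (\<Sum>\<^sub>\<infinity>mn. k ((\<lambda>(m, n). (- m - a, - n - b)) mn))"
      using infsum_reindex_bij_betw[OF bij, of k] by simp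
    also have "\<dots> = (\<Sum>\<^sub>\<infinity>mn. - k mn)"
    proof (intro infsum_cong)
      fix mn :: "int \<times> int"
      have eq: "lattice_point t ((\<lambda>(m, n). (- m - a, - n - b)) mn) = - (lattice_point t mn + \<omega>)"
        by (cases mn) (simp add: ab lattice_point_def algebra_simps)
      show "k ((\<lambda>(m, n). (- m - a, - n - b)) mn) = - k mn"
        unfolding k_def eq by (simp add: power2_eq_square algebra_simps)
    qed
    \<comment> \<open>This also covers a divergent sum, for which \<open>infsum\<close> is 0 by
      convention.\<close>
    also have "\<dots> = - infsum k UNIV" by (rule infsum_uminus)
    finally show ?thesis by simp
  qed
  finally show ?thesis
    using zeta_diff[OF shifted] zeta_diff[OF z] by (simp add: algebra_simps)
qed

section \<open>Quasi-periods\<close>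

text \<open>Each summand is homogeneous of degree -1 in z and \<omega> jointly. This is the source
  of the weight -1 of the elliptic zeta functions built from forms.\<close>

lemma weierstrass_zeta_scale:
  assumes "\<alpha> \<noteq> 0"
  shows "weierstrass_zeta ((*) \<alpha> ` L) (\<alpha> * z) = weierstrass_zeta L z / \<alpha>"
proof -
  have inj: "inj_on ((*) \<alpha>) A" for A using assms by (auto simp: inj_on_def)
  have "(*) \<alpha> ` L - {0} = (*) \<alpha> ` (L - {0})" using assms by auto
  then have "(\<Sum>\<^sub>\<infinity>\<omega>\<in>(*) \<alpha> ` L - {0}. 1 / (\<alpha> * z - \<omega>) + 1 / \<omega> + \<alpha> * z / \<omega>\<^sup>2) =
      (\<Sum>\<^sub>\<infinity>\<omega>\<in>L - {0}. 1 / (\<alpha> * z - \<alpha> * \<omega>) + 1 / (\<alpha> * \<omega>) + \<alpha> * z / (\<alpha> * \<omega>)\<^sup>2)"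
    by (simp add: infsum_reindex[OF inj] o_def)
  also have "\<dots> = (\<Sum>\<^sub>\<infinity>\<omega>\<in>L - {0}. 1 / \<alpha> * (1 / (z - \<omega>) + 1 / \<omega> + z / \<omega>\<^sup>2))"
    using assms by (intro infsum_cong)
      (simp add: distrib_left power2_eq_square flip: right_diff_distrib)
  also have "\<dots> = 1 / \<alpha> * (\<Sum>\<^sub>\<infinity>\<omega>\<in>L - {0}. 1 / (z - \<omega>) + 1 / \<omega> + z / \<omega>\<^sup>2)"
    by (rule infsum_cmult_right')
  finally show ?thesis
    using assms by (simp add: weierstrass_zeta_def add_divide_distrib)
qed

lemma period_lattice_scale: "\<Lambda> (\<alpha> * \<omega>1, \<alpha> * \<omega>2) = (*) \<alpha> ` \<Lambda> (\<omega>1, \<omega>2)"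
  unfolding period_lattice_def image_Collect by (force simp: algebra_simps)

text \<open>Scaling by -1, under which the lattice is invariant.\<close>

lemma weierstrass_zeta_uminus: "weierstrass_zeta (\<Lambda> p) (- z) = - weierstrass_zeta (\<Lambda> p) z"
proof -
  have "(*) (- 1) ` \<Lambda> p = \<Lambda> p"
    using period_lattice_uminus[of _ p] by (force simp: image_iff)
  then show ?thesis using weierstrass_zeta_scale[of "-1" "\<Lambda> p" z] by simp
qed

lemma nonlattice_coordinates:
  assumes "Im t > 0" "a \<notin> \<int> \<or> b \<notin> \<int>"
  shows "of_real a + of_real b * t \<notin> \<Lambda> (1, t)"
proof
  assume "of_real a + of_real b * t \<in> \<Lambda> (1, t)"
  then obtain m n where "of_real a + of_real b * t = of_int m + of_int n * t"
    by (auto simp: period_lattice_range lattice_point_def)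
  then have "of_real (a - of_int m) + of_real (b - of_int n) * t = 0" by (simp add: algebra_simps)
  from real_coordinates_eq_0[OF assms(1) this] assms(2) show False by auto
qed

lemma basisE:
  assumes "p \<in> bases"
  obtains \<alpha> t where "\<alpha> \<noteq> 0" "Im t > 0" "p = (\<alpha>, \<alpha> * t)"
proof -
  obtain w1 w2 where p: "p = (w1, w2)" "Im (w2 / w1) > 0" using assms by (auto simp: bases_def)
  then have "w1 \<noteq> 0" by auto
  then show thesis using p that[of w1 "w2 / w1"] by simp
qed

lemma half_period_notin:
  assumes "Im t > 0"
  shows "1 / 2 \<notin> \<Lambda> (1, t)" "- (1 / 2) \<notin> \<Lambda> (1, t)" "t / 2 \<notin> \<Lambda> (1, t)" "- (t / 2) \<notin> \<Lambda> (1, t)"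
proof -
  have half: "(1 / 2 :: real) \<notin> \<int>" "(- (1 / 2) :: real) \<notin> \<int>"
    using fraction_not_in_Ints[of 2 1, where ?'a = real] by (simp_all add: minus_in_Ints_iff)
  show "1 / 2 \<notin> \<Lambda> (1, t)" "- (1 / 2) \<notin> \<Lambda> (1, t)" "t / 2 \<notin> \<Lambda> (1, t)" "- (t / 2) \<notin> \<Lambda> (1, t)"
    using nonlattice_coordinates[OF assms, of "1/2" 0] nonlattice_coordinates[OF assms, of "-(1/2)" 0]
      nonlattice_coordinates[OF assms, of 0 "1/2"] nonlattice_coordinates[OF assms, of 0 "-(1/2)"] half
    by simp_all
qed

lemma nonlattice_exists:
  assumes "p \<in> bases"
  obtains z where "z \<notin> \<Lambda> p"
proof -
  obtain \<alpha> t where p: "\<alpha> \<noteq> 0" "Im t > 0" "p = (\<alpha>, \<alpha> * t)" using basisE[OF assms] .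
  have "\<alpha> * (1 / 2) \<notin> (*) \<alpha> ` \<Lambda> (1, t)"
    using half_period_notin(1)[OF p(2)] p(1) by (metis imageE mult_left_cancel)
  then show thesis using that period_lattice_scale[of \<alpha> 1 t] p by auto
qed

text \<open>One point off the lattice pins down the constant; without such a point the description
  in \<open>eta\<close> would be satisfied by every number.\<close>

lemma eta_eqI:
  assumes "z0 \<notin> L" and "\<And>z. z \<notin> L \<Longrightarrow> weierstrass_zeta L (z + \<omega>) = weierstrass_zeta L z + e"
  shows "eta L \<omega> = e"
  unfolding eta_def
proof (rule the_equality)
  show "e' = e" if "\<forall>z. z \<notin> L \<longrightarrow> weierstrass_zeta L (z + \<omega>) = weierstrass_zeta L z + e'" for e'
    using that assms by (metis add_left_cancel)
qed (use assms in auto)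

text \<open>By the second difference, the increment of zeta along \<omega> is the same at all
  points, so the description in \<open>eta\<close> has a solution. A general basis has the form
  \<alpha> (1, t), and dividing by \<alpha> reduces it to the case already treated.\<close>

lemma weierstrass_zeta_add_period:
  assumes p: "p \<in> bases" and \<omega>: "\<omega> \<in> \<Lambda> p" and z: "z \<notin> \<Lambda> p"
  shows "weierstrass_zeta (\<Lambda> p) (z + \<omega>) = weierstrass_zeta (\<Lambda> p) z + eta (\<Lambda> p) \<omega>"
proof -
  obtain \<alpha> t where p': "\<alpha> \<noteq> 0" "Im t > 0" "p = (\<alpha>, \<alpha> * t)" using basisE[OF p] .
  have L: "\<Lambda> p = (*) \<alpha> ` \<Lambda> (1, t)" using period_lattice_scale[of \<alpha> 1 t] p' by simp
  obtain \<omega>' where \<omega>': "\<omega> = \<alpha> * \<omega>'" "\<omega>' \<in> \<Lambda> (1, t)" using \<omega> L by auto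
  have "weierstrass_zeta (\<Lambda> p) (x + \<omega>) - weierstrass_zeta (\<Lambda> p) x =
      weierstrass_zeta (\<Lambda> p) (z + \<omega>) - weierstrass_zeta (\<Lambda> p) z" if x: "x \<notin> \<Lambda> p" for x
  proof -
    have nl: "y / \<alpha> \<notin> \<Lambda> (1, t)" if "y \<notin> \<Lambda> p" for y
      using that p'(1) by (auto simp: L image_iff)
    have zeta: "weierstrass_zeta (\<Lambda> p) y = weierstrass_zeta (\<Lambda> (1, t)) (y / \<alpha>) / \<alpha>" for y
      using weierstrass_zeta_scale[OF p'(1), of "\<Lambda> (1, t)" "y / \<alpha>"] p'(1) by (simp add: L)
    show ?thesis
      using weierstrass_zeta_second_difference[OF p'(2) nl[OF x] nl[OF z] \<omega>'(2)] p'(1)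
      by (simp add: zeta \<omega>'(1) add_divide_distrib flip: diff_divide_distrib)
  qed
  note diff = this
  have "weierstrass_zeta (\<Lambda> p) (x + \<omega>) = weierstrass_zeta (\<Lambda> p) x +
      (weierstrass_zeta (\<Lambda> p) (z + \<omega>) - weierstrass_zeta (\<Lambda> p) z)" if "x \<notin> \<Lambda> p" for x
    using diff[OF that] by (metis add.commute diff_add_cancel)
  from eta_eqI[OF z this] show ?thesis by simp
qed

lemma eta_add:
  assumes p: "p \<in> bases" and "x \<in> \<Lambda> p" "y \<in> \<Lambda> p"
  shows "eta (\<Lambda> p) (x + y) = eta (\<Lambda> p) x + eta (\<Lambda> p) y"
proof -
  obtain z where z: "z \<notin> \<Lambda> p" using nonlattice_exists[OF p] .
  have "z + x \<notin> \<Lambda> p" using z assms period_lattice_add_iff by blast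
  then show ?thesis
    using weierstrass_zeta_add_period[OF p _ z] weierstrass_zeta_add_period[OF p \<open>y \<in> \<Lambda> p\<close>, of "z + x"]
      period_lattice_add assms by (simp add: add.assoc)
qed

lemma eta_scale:
  assumes p: "(\<omega>1, \<omega>2) \<in> bases" and \<omega>: "\<omega> \<in> \<Lambda> (\<omega>1, \<omega>2)" and \<alpha>: "\<alpha> \<noteq> 0"
  shows "eta (\<Lambda> (\<alpha> * \<omega>1, \<alpha> * \<omega>2)) (\<alpha> * \<omega>) = eta (\<Lambda> (\<omega>1, \<omega>2)) \<omega> / \<alpha>"
proof -
  obtain z where z: "z \<notin> \<Lambda> (\<omega>1, \<omega>2)" using nonlattice_exists[OF p] .
  show ?thesis unfolding period_lattice_scale
  proof (rule eta_eqI)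
    show "\<alpha> * z \<notin> (*) \<alpha> ` \<Lambda> (\<omega>1, \<omega>2)" using z \<alpha> by auto
    fix x assume "x \<notin> (*) \<alpha> ` \<Lambda> (\<omega>1, \<omega>2)"
    then have x: "x / \<alpha> \<notin> \<Lambda> (\<omega>1, \<omega>2)" using \<alpha> by (auto simp: image_iff)
    have "x + \<alpha> * \<omega> = \<alpha> * (x / \<alpha> + \<omega>)" "x = \<alpha> * (x / \<alpha>)" using \<alpha> by (simp_all add: field_simps)
    then show "weierstrass_zeta ((*) \<alpha> ` \<Lambda> (\<omega>1, \<omega>2)) (x + \<alpha> * \<omega>) =
      weierstrass_zeta ((*) \<alpha> ` \<Lambda> (\<omega>1, \<omega>2)) x + eta (\<Lambda> (\<omega>1, \<omega>2)) \<omega> / \<alpha>"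
      using weierstrass_zeta_scale[OF \<alpha>] weierstrass_zeta_add_period[OF p \<omega> x]
      by (metis add_divide_distrib)
  qed
qed

lemma lattice_combination_in: "of_int m * fst p + of_int n * snd p \<in> \<Lambda> p"
  by (auto simp: period_lattice_def)

lemma generators_in_lattice: "fst p \<in> \<Lambda> p" "snd p \<in> \<Lambda> p"
  using lattice_combination_in[of 1 p 0] lattice_combination_in[of 0 p 1] by auto

text \<open>Shared by \<open>eta\<close> and by the quasi-periods of elliptic zeta functions: both
  are determined by their values on a basis.\<close>

lemma additive_on_lattice:
  assumes add: "\<And>x y. x \<in> \<Lambda> p \<Longrightarrow> y \<in> \<Lambda> p \<Longrightarrow> H (x + y) = H x + (H y :: complex)"
  shows "H (of_int m * fst p + of_int n * snd p) = of_int m * H (fst p) + of_int n * H (snd p)"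
proof -
  have 0: "H 0 = 0" using add[of 0 0] lattice_combination_in[of 0 p 0] by simp
  have mult: "H (of_int m * x) = of_int m * H x" if multiples: "\<And>m::int. of_int m * x \<in> \<Lambda> p" for m x
  proof (induction m rule: int_induct[where k = 0])
    case (step1 i)
    have "of_int (i + 1) * x = of_int i * x + x" by (simp add: algebra_simps)
    then show ?case using add[of "of_int i * x" x] multiples[of i] multiples[of 1] step1
      by (simp add: algebra_simps)
  next
    case (step2 i)
    have "of_int i * x = of_int (i - 1) * x + x" by (simp add: algebra_simps)
    then show ?case using add[of "of_int (i - 1) * x" x] multiples[of "i - 1"] multiples[of 1] step2
      by (simp add: algebra_simps)
  qed (simp add: 0)
  have "of_int m * fst p \<in> \<Lambda> p" "of_int m * snd p \<in> \<Lambda> p" for m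
    using lattice_combination_in[of m p 0] lattice_combination_in[of 0 p m] by auto
  then show ?thesis by (simp add: add mult)
qed

lemma eta_combination:
  assumes "p \<in> bases"
  shows "eta (\<Lambda> p) (of_int m * fst p + of_int n * snd p) =
    of_int m * eta (\<Lambda> p) (fst p) + of_int n * eta (\<Lambda> p) (snd p)"
  by (rule additive_on_lattice) (rule eta_add[OF assms])

section \<open>The quasi-periods at 1 and \<tau> as holomorphic functions of \<tau>\<close>

definition eta1 :: "complex \<Rightarrow> complex" where "eta1 t = eta (\<Lambda> (1, t)) 1"
definition eta2 :: "complex \<Rightarrow> complex" where "eta2 t = eta (\<Lambda> (1, t)) t"

lemma standard_basis: "Im t > 0 \<Longrightarrow> (1, t) \<in> bases"
  by (simp add: bases_def)

text \<open>Quasi-periodicity at minus half the period, combined with oddness. It turns the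
  implicitly defined \<open>eta\<close> into an explicit sum at a point with constant coordinates in
  the basis (1, t), and so gives access to the dependence on t.\<close>

lemma eta_half_period:
  assumes t: "Im t > 0"
  shows "eta1 t = 2 * weierstrass_zeta (\<Lambda> (1, t)) (1 / 2)"
    and "eta2 t = 2 * weierstrass_zeta (\<Lambda> (1, t)) (t / 2)"
  using weierstrass_zeta_add_period[OF standard_basis[OF t], of 1 "- (1 / 2)"]
    weierstrass_zeta_add_period[OF standard_basis[OF t], of t "- (t / 2)"]
    half_period_notin[OF t] generators_in_lattice[of "(1, t)"] weierstrass_zeta_uminus[of "(1, t)"]
  by (simp_all add: eta1_def eta2_def)

text \<open>The radius 3/4 lies above 1/2, which admits the half periods and the corners of the
  centred period parallelogram, and below 1, which leaves distance 1/4 from every nonzero pair of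
  integers. With r = 3/2 and d = 1/4 the constant 1 + (r + 1) / d is 11.\<close>

lemma central_cell_bound:
  fixes a b :: real
  assumes "\<bar>a\<bar> \<le> 3/4" "\<bar>b\<bar> \<le> 3/4" "(m, n) \<noteq> (0, 0)"
  shows "1 + (\<bar>of_int m\<bar> + \<bar>of_int n\<bar>) \<le> 11 * (\<bar>a - of_int m\<bar> + \<bar>b - of_int n\<bar>)"
proof -
  have far: "1 / 4 \<le> \<bar>x - of_int k\<bar>" if "\<bar>x\<bar> \<le> 3/4" "k \<noteq> 0" for x :: real and k :: int
  proof -
    have "\<bar>real_of_int k\<bar> \<ge> 1" using that(2) by linarith
    then show ?thesis using that(1) by linarith
  qed
  have "1 / 4 \<le> \<bar>a - of_int m\<bar> + \<bar>b - of_int n\<bar>"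
    using far[OF assms(1), of m] far[OF assms(2), of n] assms(3) by (cases "m = 0") (simp_all add: add_increasing add_increasing2)
  from coordinate_distance_bound[OF _ this, of "3/2"] show ?thesis
    using assms by simp
qed

text \<open>The real coordinates stay fixed while the basis moves with t. The pairs (1/2, 0) and (0,
  1/2) are the half periods from which \<open>eta1\<close> and \<open>eta2\<close> are read
  off.\<close>

lemma zeta_regular_holomorphic_in_basis:
  fixes a b :: real
  assumes ab: "\<bar>a\<bar> \<le> 3/4" "\<bar>b\<bar> \<le> 3/4"
  shows "(\<lambda>t. zeta_regular t (of_real a + of_real b * t)) holomorphic_on \<H>"
  unfolding holomorphic_on_def
proof
  fix t0 assume "t0 \<in> \<H>"
  then have t0: "Im t0 > 0" by (simp add: upper_half_plane_def)
  \<comment> \<open>On U the imaginary part exceeds e and the norm stays below R, so the constant of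
    \<open>real_coordinates_le\<close> is at most C throughout U.\<close>
  define e where "e = Im t0 / 2"
  define R where "R = norm t0 + 1"
  define U where "U = {t. e < Im t} \<inter> ball 0 R"
  have e: "e > 0" using t0 by (simp add: e_def)
  have U: "open U" unfolding U_def by (intro open_Int open_halfspace_Im_gt open_ball)
  have t0U: "t0 \<in> U" using t0 by (simp add: U_def e_def R_def)
  define C where "C = 1 + (1 + R) / e"
  have "(\<lambda>t. zeta_regular t (of_real a + of_real b * t)) holomorphic_on U"
    unfolding zeta_regular_def
  proof (rule holomorphic_infsum[OF U])
    fix mn :: "int \<times> int" assume mn: "mn \<in> -{(0, 0)}"
    obtain m n where [simp]: "mn = (m, n)" by (cases mn)
    have facts: "of_real a + of_real b * t - lattice_point t mn \<noteq> 0 \<and> lattice_point t mn \<noteq> 0 \<and>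
        norm (1 / (of_real a + of_real b * t - lattice_point t mn) + 1 / lattice_point t mn +
          (of_real a + of_real b * t) / (lattice_point t mn)\<^sup>2) \<le> 4 * (1 + R)\<^sup>2 * C ^ 3 * 11 * lattice_weight mn"
      if "t \<in> U" for t
    proof -
      have t: "e < Im t" "norm t < R" using that by (auto simp: U_def)
      then have t': "Im t > 0" using e by linarith
      have "(1 + norm t) / Im t \<le> (1 + R) / e" using t e norm_ge_zero[of t] by (intro frac_le) linarith+
      then have C: "1 + (1 + norm t) / Im t \<le> C" by (simp add: C_def)
      have "norm (of_real a + of_real b * t) \<le> \<bar>a\<bar> + \<bar>b\<bar> * norm t"
        by (metis norm_mult norm_of_real norm_triangle_ineq)
      also have "\<dots> \<le> 1 + 1 * R" using ab t by (intro add_mono mult_mono) auto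
      finally have B: "norm (of_real a + of_real b * t) \<le> 1 + R" by simp
      show ?thesis
        using zeta_term_bound[OF t' C refl B central_cell_bound[OF ab] _ _ refl] mn by simp
    qed
    show "(\<lambda>t. 1 / (of_real a + of_real b * t - lattice_point t mn) + 1 / lattice_point t mn +
          (of_real a + of_real b * t) / (lattice_point t mn)\<^sup>2) holomorphic_on U"
      using facts by (auto simp: lattice_point_def intro!: holomorphic_intros)
    show "norm (1 / (of_real a + of_real b * t - lattice_point t mn) + 1 / lattice_point t mn +
          (of_real a + of_real b * t) / (lattice_point t mn)\<^sup>2) \<le> 4 * (1 + R)\<^sup>2 * C ^ 3 * 11 * lattice_weight mn"
      if "t \<in> U" for t
      using facts[OF that] by blast
  qed (intro summable_on_cmult_right summable_lattice_weight)
  then show "(\<lambda>t. zeta_regular t (of_real a + of_real b * t)) field_differentiable at t0 within \<H>"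
    using U t0U by (metis field_differentiable_at_within holomorphic_on_imp_differentiable_at)
qed

lemma eta_holomorphic: "eta1 holomorphic_on \<H>" "eta2 holomorphic_on \<H>"
proof -
  have Im: "t \<in> \<H> \<longleftrightarrow> Im t > 0" for t by (simp add: upper_half_plane_def)
  have "(\<lambda>t. 2 * (1 / (1 / 2) + zeta_regular t (1 / 2))) holomorphic_on \<H>"
    using zeta_regular_holomorphic_in_basis[of "1/2" 0] by (intro holomorphic_intros) simp_all
  then show "eta1 holomorphic_on \<H>"
    by (rule holomorphic_transform) (simp add: Im eta_half_period weierstrass_zeta_eq_regular)
  have "(\<lambda>t. 2 * (1 / (t / 2) + zeta_regular t (t / 2))) holomorphic_on \<H>"
    using zeta_regular_holomorphic_in_basis[of 0 "1/2"] by (intro holomorphic_intros) (auto simp: Im)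
  then show "eta2 holomorphic_on \<H>"
    by (rule holomorphic_transform) (simp add: Im eta_half_period weierstrass_zeta_eq_regular)
qed

section \<open>Non-vanishing of the Legendre determinant\<close>

text \<open>Substituting -u changes the sign of du and, by oddness, that of f; the two signs
  cancel.\<close>

lemma contour_integral_linepath_odd:
  assumes "\<And>u. u \<in> closed_segment a b \<Longrightarrow> f (- u) = - f u"
  shows "contour_integral (linepath (- a) (- b)) f = contour_integral (linepath a b) f"
proof -
  have "linepath (- a) (- b) = uminus \<circ> linepath a b"
    by (auto simp: linepath_def)
  then have "contour_integral (linepath (- a) (- b)) f = - contour_integral (linepath a b) (\<lambda>x. f (- x))"
    by (simp add: contour_integral_negatepath)
  also have "contour_integral (linepath a b) (\<lambda>x. f (- x)) = contour_integral (linepath a b) (\<lambda>x. - f x)"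
    using assms by (intro contour_integral_eq) simp
  finally show ?thesis by (simp add: contour_integral_neg)
qed

lemma contour_integral_linepath_quasi_periodic:
  assumes "\<And>u. u \<in> closed_segment a b \<Longrightarrow> f (u + s) = f u + h"
    and "continuous_on (closed_segment a b) f"
  shows "contour_integral (linepath (a + s) (b + s)) f = contour_integral (linepath a b) f + h * (b - a)"
proof -
  have "linepath (a + s) (b + s) = (+) s \<circ> linepath a b"
    by (auto simp: linepath_def algebra_simps scaleR_conv_of_real)
  then have "contour_integral (linepath (a + s) (b + s)) f = contour_integral (linepath a b) (\<lambda>x. f (x + s))"
    by (simp add: contour_integral_translate)
  also have "\<dots> = contour_integral (linepath a b) (\<lambda>x. f x + h)"
    using assms(1) by (intro contour_integral_eq) simp
  also have "\<dots> = contour_integral (linepath a b) f + contour_integral (linepath a b) (\<lambda>x. h)"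
    using assms(2) by (intro contour_integral_add contour_integrable_continuous_linepath) auto
  finally show ?thesis by simp
qed

text \<open>The two expressions are the real coordinates of z in the basis (1, t). For Im t > 0 the
  cell contains the closed period parallelogram centred at 0, and 0 is its only lattice
  point.\<close>

definition central_cell :: "complex \<Rightarrow> complex set" where
  "central_cell t = {z. \<bar>Re z - Im z / Im t * Re t\<bar> < 3/4 \<and> \<bar>Im z / Im t\<bar> < 3/4}"

text \<open>Openness and convexity of the cell can be read off from this form.\<close>

lemma central_cell_halfspaces:
  "central_cell t = {z. Complex 1 (- Re t / Im t) \<bullet> z < 3/4} \<inter> {z. - Complex 1 (- Re t / Im t) \<bullet> z < 3/4}
    \<inter> ({z. Complex 0 (1 / Im t) \<bullet> z < 3/4} \<inter> {z. - Complex 0 (1 / Im t) \<bullet> z < 3/4})"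
proof -
  have "Complex 1 (- Re t / Im t) \<bullet> z = Re z - Im z / Im t * Re t"
    "Complex 0 (1 / Im t) \<bullet> z = Im z / Im t" for z
    by (simp_all add: inner_complex_def)
  then show ?thesis
    by (auto simp only: central_cell_def inner_minus_left abs_less_iff Int_iff mem_Collect_eq)
qed

lemma open_central_cell: "open (central_cell t)"
  unfolding central_cell_halfspaces by (intro open_Int open_halfspace_lt)

lemma convex_central_cell: "convex (central_cell t)"
  unfolding central_cell_halfspaces by (intro convex_Int convex_halfspace_lt)

lemma in_central_cell_iff:
  "Im t > 0 \<Longrightarrow> of_real a + of_real b * t \<in> central_cell t \<longleftrightarrow> \<bar>a\<bar> < 3/4 \<and> \<bar>b\<bar> < 3/4"
  by (simp add: central_cell_def abs_mult)

text \<open>The same majorant as for the dependence on t, now with t fixed. The summand with its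
  pole at 0 has been split off, so the origin causes no trouble.\<close>

lemma zeta_regular_holomorphic:
  assumes t: "Im t > 0"
  shows "zeta_regular t holomorphic_on central_cell t"
  unfolding zeta_regular_def
proof (rule holomorphic_infsum[OF open_central_cell])
  fix mn :: "int \<times> int" assume mn: "mn \<in> -{(0, 0)}"
  obtain m n where [simp]: "mn = (m, n)" by (cases mn)
  have facts: "z - lattice_point t mn \<noteq> 0 \<and> lattice_point t mn \<noteq> 0 \<and>
      norm (1 / (z - lattice_point t mn) + 1 / lattice_point t mn + z / (lattice_point t mn)\<^sup>2)
        \<le> 4 * (1 + norm t)\<^sup>2 * (1 + (1 + norm t) / Im t) ^ 3 * 11 * lattice_weight mn"
    if z: "z \<in> central_cell t" for z
  proof -
    obtain a b where ab: "z = of_real a + of_real b * t" using real_coordinates_exist[OF t] .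
    then have le: "\<bar>a\<bar> \<le> 3/4" "\<bar>b\<bar> \<le> 3/4" using z in_central_cell_iff[OF t] by auto
    have "norm z \<le> \<bar>a\<bar> + \<bar>b\<bar> * norm t"
      unfolding ab by (metis norm_mult norm_of_real norm_triangle_ineq)
    also have "\<dots> \<le> 1 + 1 * norm t" using le by (intro add_mono mult_right_mono) auto
    finally have B: "norm z \<le> 1 + norm t" by simp
    show ?thesis
      using zeta_term_bound[OF t order_refl ab B central_cell_bound[OF le] _ _ refl] mn by simp
  qed
  show "(\<lambda>z. 1 / (z - lattice_point t mn) + 1 / lattice_point t mn + z / (lattice_point t mn)\<^sup>2)
      holomorphic_on central_cell t"
    using facts by (intro holomorphic_intros) auto
  show "norm (1 / (z - lattice_point t mn) + 1 / lattice_point t mn + z / (lattice_point t mn)\<^sup>2)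
        \<le> 4 * (1 + norm t)\<^sup>2 * (1 + (1 + norm t) / Im t) ^ 3 * 11 * lattice_weight mn"
    if "z \<in> central_cell t" for z
    using facts[OF that] by blast
qed (intro summable_on_cmult_right summable_lattice_weight)

lemma zeta_regular_uminus:
  assumes "Im t > 0"
  shows "zeta_regular t (- z) = - zeta_regular t z"
  using weierstrass_zeta_uminus[of "(1, t)" z] by (simp add: weierstrass_zeta_eq_regular[OF assms])

text \<open>
  On the path \<open>A \<rightarrow> B \<rightarrow> C\<close>, half of the boundary of the period parallelogram centred at \<open>0\<close>,
  oddness and quasi-periodicity give \<open>\<integral>\<zeta> = (\<tau> \<eta>\<^sub>1 - \<eta>\<^sub>2) / 2\<close>. As \<open>\<zeta>(z) - 1 / z\<close> is odd and holomorphic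
  on the triangle \<open>A B C\<close>, this equals \<open>\<integral>dz / z\<close>, whose exponential is \<open>C / A = -1\<close>.
\<close>
lemma eta_determinant_nonzero:
  assumes t: "Im t > 0"
  shows "t * eta1 t - eta2 t \<noteq> 0"
proof -
  define A B C where "A = - (1 + t) / 2" and "B = (1 - t) / 2" and "C = (1 + t) / 2"
  let ?z = "weierstrass_zeta (\<Lambda> (1, t))"
  let ?R = "zeta_regular t"
  have coords: "A = of_real (- (1/2)) + of_real (- (1/2)) * t" "B = of_real (1/2) + of_real (- (1/2)) * t"
    "C = of_real (1/2) + of_real (1/2) * t" "- B = of_real (- (1/2)) + of_real (1/2) * t"
    by (simp_all add: A_def B_def C_def field_simps)
  have cell: "A \<in> central_cell t" "B \<in> central_cell t" "C \<in> central_cell t"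
    "- B \<in> central_cell t"
    unfolding coords(4) unfolding coords(1-3) in_central_cell_iff[OF t] by auto
  have half: "(1 / 2 :: real) \<notin> \<int>" "(- (1 / 2) :: real) \<notin> \<int>"
    using fraction_not_in_Ints[of 2 1, where ?'a = real] by (simp_all add: minus_in_Ints_iff)
  have seg: "closed_segment x y \<subseteq> central_cell t" if "x \<in> central_cell t" "y \<in> central_cell t" for x y
    using that convex_central_cell closed_segment_subset by blast
  have nlAB: "u \<notin> \<Lambda> (1, t)" if u: "u \<in> closed_segment A B" for u
  proof -
    obtain s where "u = (1 - s) *\<^sub>R A + s *\<^sub>R B" using u by (auto simp: in_segment)
    then have "u = of_real (s - 1/2) + of_real (- (1/2)) * t"
      by (simp add: coords scaleR_conv_of_real field_simps; algebra)
    then show ?thesis using nonlattice_coordinates[OF t] half by metis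
  qed
  have nlBC: "u \<notin> \<Lambda> (1, t)" if u: "u \<in> closed_segment B C" for u
  proof -
    obtain s where "u = (1 - s) *\<^sub>R B + s *\<^sub>R C" using u by (auto simp: in_segment)
    then have "u = of_real (1/2) + of_real (s - 1/2) * t"
      by (simp add: coords scaleR_conv_of_real field_simps; algebra)
    then show ?thesis using nonlattice_coordinates[OF t] half by metis
  qed
  have nlAD: "u \<notin> \<Lambda> (1, t)" if u: "u \<in> closed_segment A (- B)" for u
  proof -
    obtain s where "u = (1 - s) *\<^sub>R A + s *\<^sub>R (- B)" using u by (auto simp: in_segment)
    then have "u = of_real (- (1/2)) + of_real (s - 1/2) * t"
      by (simp add: coords scaleR_conv_of_real field_simps; algebra)
    then show ?thesis using nonlattice_coordinates[OF t] half by metis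
  qed
  have zero: "0 \<in> \<Lambda> (1, t)" using lattice_combination_in[of 0 "(1, t)" 0] by simp
  have contR: "continuous_on (closed_segment x y) ?R"
    if "x \<in> central_cell t" "y \<in> central_cell t" for x y
    using continuous_on_subset[OF holomorphic_on_imp_continuous_on[OF zeta_regular_holomorphic[OF t]] seg] that
    by blast
  have contI: "continuous_on (closed_segment x y) (\<lambda>z. 1 / z)" if "0 \<notin> closed_segment x y" for x y :: complex
    using that by (intro continuous_intros) auto
  have zR: "?z = (\<lambda>z. 1 / z + ?R z)" using weierstrass_zeta_eq_regular[OF t] by auto
  have cont: "continuous_on (closed_segment x y) ?z"
    if "x \<in> central_cell t" "y \<in> central_cell t" "0 \<notin> closed_segment x y" for x y
    unfolding zR using contR contI that by (intro continuous_on_add) auto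
  have split: "contour_integral (linepath x y) ?z =
      contour_integral (linepath x y) (\<lambda>z. 1 / z) + contour_integral (linepath x y) ?R"
    if "x \<in> central_cell t" "y \<in> central_cell t" "0 \<notin> closed_segment x y" for x y
    unfolding zR using contR contI that
    by (intro contour_integral_add contour_integrable_continuous_linepath) auto
  have 0: "0 \<notin> closed_segment A B" "0 \<notin> closed_segment B C" "0 \<notin> closed_segment A (- B)"
    using nlAB nlBC nlAD zero by auto
  \<comment> \<open>The translate of A \<rightarrow> B by t is -B \<rightarrow> -A. By oddness its
    integral is minus the one over A \<rightarrow> B, while quasi-periodicity says that the two
    differ by \<open>eta2 t\<close>.\<close>
  have 1: "contour_integral (linepath A B) ?z = - eta2 t / 2"
  proof -
    have "contour_integral (linepath (A + t) (B + t)) ?z = contour_integral (linepath A B) ?z + eta2 t * (B - A)"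
      using weierstrass_zeta_add_period[OF standard_basis[OF t]] nlAB generators_in_lattice[of "(1, t)"]
      by (intro contour_integral_linepath_quasi_periodic cont cell 0) (auto simp: eta2_def)
    moreover have "A + t = - B" "B + t = - A" "B - A = 1"
      by (simp_all add: A_def B_def field_simps)
    moreover have "contour_integral (linepath (- B) (- A)) ?z = contour_integral (linepath B A) ?z"
      by (intro contour_integral_linepath_odd weierstrass_zeta_uminus)
    moreover have "contour_integral (linepath B A) ?z = - contour_integral (linepath A B) ?z"
      using contour_integral_reverse_linepath[OF cont[OF cell(1,2) 0(1)]] by simp
    ultimately have "- contour_integral (linepath A B) ?z = contour_integral (linepath A B) ?z + eta2 t * 1"
      by metis
    then have "2 * contour_integral (linepath A B) ?z = - eta2 t" by algebra
    then show ?thesis by (metis nonzero_mult_div_cancel_left zero_neq_numeral)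
  qed
  \<comment> \<open>Here the edge A \<rightarrow> -B is translated by 1 to B \<rightarrow> C; as A =
    -C, oddness identifies its integral with minus the one over B \<rightarrow> C.\<close>
  have 2: "contour_integral (linepath B C) ?z = t * eta1 t / 2"
  proof -
    have "contour_integral (linepath (A + 1) (- B + 1)) ?z =
        contour_integral (linepath A (- B)) ?z + eta1 t * (- B - A)"
      using weierstrass_zeta_add_period[OF standard_basis[OF t]] nlAD generators_in_lattice[of "(1, t)"]
      by (intro contour_integral_linepath_quasi_periodic cont cell 0) (auto simp: eta1_def)
    moreover have "A + 1 = B" "- B + 1 = C" "- B - A = t"
      by (simp_all add: A_def B_def C_def field_simps)
    moreover have "A = - C" by (simp add: A_def C_def field_simps)
    moreover have "contour_integral (linepath (- C) (- B)) ?z = contour_integral (linepath C B) ?z"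
      by (intro contour_integral_linepath_odd weierstrass_zeta_uminus)
    moreover have "contour_integral (linepath C B) ?z = - contour_integral (linepath B C) ?z"
      using contour_integral_reverse_linepath[OF cont[OF cell(2,3) 0(2)]] by simp
    ultimately have "contour_integral (linepath B C) ?z = - contour_integral (linepath B C) ?z + eta1 t * t"
      by metis
    then have "2 * contour_integral (linepath B C) ?z = t * eta1 t" by algebra
    then show ?thesis by (metis nonzero_mult_div_cancel_left zero_neq_numeral)
  qed
  have "convex hull {A, B, C} \<subseteq> central_cell t"
    using cell by (intro hull_minimal convex_central_cell) auto
  then have "(?R has_contour_integral 0) (linepath A B +++ linepath B C +++ linepath C A)"
    by (intro Cauchy_theorem_triangle holomorphic_on_subset[OF zeta_regular_holomorphic[OF t]])
  from contour_integral_unique[OF this]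
  have tri: "contour_integral (linepath A B) ?R + contour_integral (linepath B C) ?R
      + contour_integral (linepath C A) ?R = 0"
    using cell by (simp add: contR contour_integrable_continuous_linepath add.assoc)
  \<comment> \<open>The closing edge runs through the origin, where zeta itself could not be
    integrated. The regular part can, and it is odd on a segment symmetric about 0.\<close>
  have 3: "contour_integral (linepath C A) ?R = 0"
  proof -
    have "contour_integral (linepath (- C) (- A)) ?R = contour_integral (linepath C A) ?R"
      by (intro contour_integral_linepath_odd zeta_regular_uminus t)
    moreover have "- C = A" "- A = C" by (simp_all add: A_def C_def field_simps)
    moreover have "contour_integral (linepath A C) ?R = - contour_integral (linepath C A) ?R"
      using contour_integral_reverse_linepath[OF contR[OF cell(1,3)]] by simp
    ultimately show ?thesis by simp
  qed
  \<comment> \<open>The winding number formula replaces a choice of logarithm: along a segment that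
    avoids 0, the exponential of the integral of 1 / z is the ratio of the end points.\<close>
  have exp: "y = exp (contour_integral (linepath x y) (\<lambda>z. 1 / z)) * x" if "0 \<notin> closed_segment x y" for x y :: complex
    using winding_number_exp_2pi[of "linepath x y" 0] winding_number_valid_path[of "linepath x y" 0] that by simp
  have "C = exp (contour_integral (linepath A B) (\<lambda>z. 1 / z) + contour_integral (linepath B C) (\<lambda>z. 1 / z)) * A"
    unfolding exp_add using exp[OF 0(1)] exp[OF 0(2)] by (metis mult.assoc mult.commute)
  moreover have "C = - A" "A \<noteq> 0" using 0 by (auto simp: A_def C_def field_simps)
  ultimately have nonzero: "contour_integral (linepath A B) (\<lambda>z. 1 / z) + contour_integral (linepath B C) (\<lambda>z. 1 / z) \<noteq> 0"
    by auto
  show ?thesis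
  proof
    assume "t * eta1 t - eta2 t = 0"
    then have "contour_integral (linepath A B) ?z + contour_integral (linepath B C) ?z = 0"
      unfolding 1 2 by simp
    then have "contour_integral (linepath A B) (\<lambda>z. 1 / z) + contour_integral (linepath B C) (\<lambda>z. 1 / z) = 0"
      using split[OF cell(1,2) 0(1)] split[OF cell(2,3) 0(2)] tri 3 by algebra
    then show False using nonzero by contradiction
  qed
qed

section \<open>The modular action on bases and quasi-periods\<close>

lemma det_one_entries:
  fixes \<gamma> :: "int^2^2"
  assumes "det \<gamma> = 1"
  shows "\<gamma>$1$1 * \<gamma>$2$2 - \<gamma>$1$2 * \<gamma>$2$1 = 1"
    and "of_int (\<gamma>$1$1) * of_int (\<gamma>$2$2) - of_int (\<gamma>$1$2) * of_int (\<gamma>$2$1) = (1 :: 'a :: comm_ring_1)"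
proof -
  show *: "\<gamma>$1$1 * \<gamma>$2$2 - \<gamma>$1$2 * \<gamma>$2$1 = 1" using assms by (simp add: det_2)
  show "of_int (\<gamma>$1$1) * of_int (\<gamma>$2$2) - of_int (\<gamma>$1$2) * of_int (\<gamma>$2$1) = (1 :: 'a)"
    using arg_cong[OF *, of "of_int :: int \<Rightarrow> 'a"] by simp
qed

lemma automorphy_nonzero:
  assumes "det \<gamma> = 1" "Im \<tau> > 0"
  shows "automorphy \<gamma> \<tau> \<noteq> 0"
proof
  assume eq: "automorphy \<gamma> \<tau> = 0"
  then have "Im (automorphy \<gamma> \<tau>) = 0" by simp
  then have c: "\<gamma>$2$1 = 0" using assms(2) by (simp add: automorphy_def)
  then have "\<gamma>$2$2 = 0" using eq by (simp add: automorphy_def)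
  then show False using det_one_entries(1)[OF assms(1)] c by simp
qed

lemma moebius_upper_half_plane:
  assumes "det \<gamma> = 1" "Im \<tau> > 0"
  shows "Im (moebius \<gamma> \<tau>) > 0"
proof -
  let ?a = "of_int (\<gamma>$1$1) :: real" and ?b = "of_int (\<gamma>$1$2) :: real"
  let ?c = "of_int (\<gamma>$2$1) :: real" and ?d = "of_int (\<gamma>$2$2) :: real"
  have "Im ((of_int (\<gamma>$1$1) * \<tau> + of_int (\<gamma>$1$2)) * cnj (automorphy \<gamma> \<tau>)) = (?a * ?d - ?b * ?c) * Im \<tau>"
    by (simp add: automorphy_def algebra_simps)
  also have "\<dots> = Im \<tau>" using det_one_entries(2)[OF assms(1), where ?'a = real] by simp
  finally have "Im (moebius \<gamma> \<tau>) = Im \<tau> / (norm (automorphy \<gamma> \<tau>))\<^sup>2"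
    by (simp add: moebius_def complex_div_cnj[of _ "automorphy \<gamma> \<tau>"] flip: of_real_power)
  then show ?thesis using assms automorphy_nonzero by simp
qed

lemma moebius_in_H: "det \<gamma> = 1 \<Longrightarrow> \<tau> \<in> \<H> \<Longrightarrow> moebius \<gamma> \<tau> \<in> \<H>"
  using moebius_upper_half_plane by (simp add: upper_half_plane_def)

lemma moebius_diff:
  assumes "det \<gamma> = 1" "automorphy \<gamma> z \<noteq> 0" "automorphy \<gamma> w \<noteq> 0"
  shows "moebius \<gamma> z - moebius \<gamma> w = (z - w) / (automorphy \<gamma> z * automorphy \<gamma> w)"
proof -
  let ?a = "of_int (\<gamma>$1$1) :: complex" and ?b = "of_int (\<gamma>$1$2) :: complex"
  have "moebius \<gamma> z - moebius \<gamma> w =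
      ((?a * z + ?b) * automorphy \<gamma> w - (?a * w + ?b) * automorphy \<gamma> z) / (automorphy \<gamma> z * automorphy \<gamma> w)"
    using assms(2,3) by (simp add: moebius_def diff_frac_eq)
  also have "(?a * z + ?b) * automorphy \<gamma> w - (?a * w + ?b) * automorphy \<gamma> z = z - w"
    using det_one_entries(2)[OF assms(1), where ?'a = complex] unfolding automorphy_def by algebra
  finally show ?thesis .
qed

text \<open>By \<open>moebius_diff\<close> the map is injective on \<open>\<H>\<close>, so punctured
  neighbourhoods go into punctured neighbourhoods. Statements that hold only near a point, not at
  it, can thus be transported along \<gamma>.\<close>

lemma filterlim_moebius:
  assumes "det \<gamma> = 1" "\<tau> \<in> \<H>"
  shows "filterlim (moebius \<gamma>) (at (moebius \<gamma> \<tau>)) (at \<tau>)"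
proof (rule filterlim_atI)
  have nz: "automorphy \<gamma> z \<noteq> 0" if "z \<in> \<H>" for z
    using that assms automorphy_nonzero by (simp add: upper_half_plane_def)
  have "isCont (moebius \<gamma>) \<tau>"
    using nz[OF assms(2)] unfolding moebius_def automorphy_def by (intro continuous_intros) auto
  then show "(moebius \<gamma> \<longlongrightarrow> moebius \<gamma> \<tau>) (at \<tau>)" by (simp add: isCont_def)
  have "open \<H>" unfolding upper_half_plane_def by (rule open_halfspace_Im_gt)
  then have "\<forall>\<^sub>F z in at \<tau>. z \<in> \<H> - {\<tau>}" using assms(2) by (rule eventually_at_in_open)
  then show "\<forall>\<^sub>F z in at \<tau>. moebius \<gamma> z \<noteq> moebius \<gamma> \<tau>"
  proof eventually_elim
    case (elim z)
    then show ?case using moebius_diff[OF assms(1) nz nz[OF assms(2)], of z] nz[of z] nz[OF assms(2)] by auto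
  qed
qed

definition adjugate :: "int^2^2 \<Rightarrow> int^2^2" where
  "adjugate \<gamma> = vector [vector [\<gamma>$2$2, - \<gamma>$1$2], vector [- \<gamma>$2$1, \<gamma>$1$1]]"

lemma adjugate_entries [simp]:
  "adjugate \<gamma> $ 1 $ 1 = \<gamma>$2$2" "adjugate \<gamma> $ 1 $ 2 = - \<gamma>$1$2"
  "adjugate \<gamma> $ 2 $ 1 = - \<gamma>$2$1" "adjugate \<gamma> $ 2 $ 2 = \<gamma>$1$1"
  by (simp_all add: adjugate_def)

lemma det_adjugate: "det (adjugate \<gamma>) = det \<gamma>"
  by (simp add: det_2 mult.commute)

lemma adjugate_mult:
  assumes "det \<gamma> = 1"
  shows "adjugate \<gamma> ** \<gamma> = mat 1"
  using det_one_entries(1)[OF assms]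
  by (simp add: vec_eq_iff forall_2 matrix_matrix_mult_def sum_2 mat_def algebra_simps)

lemma group_SL2Z: "group SL2Z"
proof (rule groupI)
  fix \<gamma> assume "\<gamma> \<in> carrier SL2Z"
  then show "\<exists>\<delta>\<in>carrier SL2Z. \<delta> \<otimes>\<^bsub>SL2Z\<^esub> \<gamma> = \<one>\<^bsub>SL2Z\<^esub>"
    by (intro bexI[of _ "adjugate \<gamma>"]) (simp_all add: SL2Z_def adjugate_mult det_adjugate)
qed (auto simp: SL2Z_def det_mul matrix_mul_assoc)

lemma basis_act_mult: "basis_act (\<gamma> ** \<delta>) p = basis_act \<gamma> (basis_act \<delta> p)"
  by (cases p) (simp add: matrix_matrix_mult_def sum_2 algebra_simps)

lemma basis_act_one: "basis_act (mat 1) p = p"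
  by (cases p) (simp add: mat_def)

lemma basis_act_scale:
  "basis_act \<gamma> (\<alpha> * \<omega>1, \<alpha> * \<omega>2) = (\<lambda>(x, y). (\<alpha> * x, \<alpha> * y)) (basis_act \<gamma> (\<omega>1, \<omega>2))"
  by (simp add: algebra_simps)

lemma scale_basis_class: "scale_class \<alpha> (basis_class \<Gamma> (\<omega>1, \<omega>2)) = basis_class \<Gamma> (\<alpha> * \<omega>1, \<alpha> * \<omega>2)"
  unfolding scale_class_def basis_class_def image_image basis_act_scale ..

lemma period_lattice_act_subset: "\<Lambda> (basis_act \<gamma> p) \<subseteq> \<Lambda> p"
proof
  fix x assume "x \<in> \<Lambda> (basis_act \<gamma> p)"
  then obtain m n where "x = of_int m * fst (basis_act \<gamma> p) + of_int n * snd (basis_act \<gamma> p)"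
    by (auto simp: period_lattice_def)
  then have "x = of_int (m * \<gamma>$2$2 + n * \<gamma>$1$2) * fst p + of_int (m * \<gamma>$2$1 + n * \<gamma>$1$1) * snd p"
    by (cases p) (simp add: algebra_simps)
  then show "x \<in> \<Lambda> p" using lattice_combination_in by metis
qed

lemma period_lattice_act:
  assumes "det \<gamma> = 1"
  shows "\<Lambda> (basis_act \<gamma> p) = \<Lambda> p"
proof
  have "\<Lambda> (basis_act (adjugate \<gamma>) (basis_act \<gamma> p)) \<subseteq> \<Lambda> (basis_act \<gamma> p)"
    by (rule period_lattice_act_subset)
  then show "\<Lambda> p \<subseteq> \<Lambda> (basis_act \<gamma> p)"
    by (simp add: adjugate_mult[OF assms] basis_act_one flip: basis_act_mult)
qed (rule period_lattice_act_subset)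

lemma basis_act_standard:
  assumes "automorphy \<gamma> \<tau> \<noteq> 0"
  shows "basis_act \<gamma> (1, \<tau>) = (automorphy \<gamma> \<tau> * 1, automorphy \<gamma> \<tau> * moebius \<gamma> \<tau>)"
  using assms by (simp add: moebius_def) (simp add: automorphy_def)

lemma basis_act_ratio:
  assumes "det \<gamma> = 1" "(\<omega>1, \<omega>2) \<in> bases"
  obtains \<alpha> where "\<alpha> \<noteq> 0" "\<alpha> = automorphy \<gamma> (\<omega>2 / \<omega>1) * \<omega>1"
    "basis_act \<gamma> (\<omega>1, \<omega>2) = (\<alpha>, \<alpha> * moebius \<gamma> (\<omega>2 / \<omega>1))"
proof -
  have t: "Im (\<omega>2 / \<omega>1) > 0" using assms(2) by (simp add: bases_def)
  then have w: "\<omega>1 \<noteq> 0" by auto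
  have j: "automorphy \<gamma> (\<omega>2 / \<omega>1) \<noteq> 0" using automorphy_nonzero[OF assms(1) t] .
  show thesis
  proof (rule that[OF _ refl])
    show "automorphy \<gamma> (\<omega>2 / \<omega>1) * \<omega>1 \<noteq> 0" using w j by simp
    have "basis_act \<gamma> (\<omega>1, \<omega>2) = basis_act \<gamma> (\<omega>1 * 1, \<omega>1 * (\<omega>2 / \<omega>1))" using w by simp
    then show "basis_act \<gamma> (\<omega>1, \<omega>2) =
        (automorphy \<gamma> (\<omega>2 / \<omega>1) * \<omega>1, automorphy \<gamma> (\<omega>2 / \<omega>1) * \<omega>1 * moebius \<gamma> (\<omega>2 / \<omega>1))"
      unfolding basis_act_scale basis_act_standard[OF j] by simp
  qed
qed

text \<open>With j = c \<tau> + d, multiplication by j carries the lattice of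
  \<open>moebius \<gamma> \<tau>\<close> to that of \<tau>, and it sends the generators to c \<tau>
  + d and a \<tau> + b, where \<open>eta\<close> is a combination of \<open>eta1\<close> and
  \<open>eta2\<close>. The first law also reads j^2 \<open>eta1\<close> + c j (\<open>eta2\<close> -
  \<tau> \<open>eta1\<close>): weight 2 up to a term that is nonzero for c \<noteq> 0.\<close>

lemma eta_moebius:
  assumes "det \<gamma> = 1" "Im \<tau> > 0"
  shows "eta1 (moebius \<gamma> \<tau>) = automorphy \<gamma> \<tau> * (of_int (\<gamma>$2$1) * eta2 \<tau> + of_int (\<gamma>$2$2) * eta1 \<tau>)"
    and "eta2 (moebius \<gamma> \<tau>) = automorphy \<gamma> \<tau> * (of_int (\<gamma>$1$1) * eta2 \<tau> + of_int (\<gamma>$1$2) * eta1 \<tau>)"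
proof -
  have j: "automorphy \<gamma> \<tau> \<noteq> 0" using automorphy_nonzero[OF assms] .
  have b: "(1, moebius \<gamma> \<tau>) \<in> bases"
    using moebius_upper_half_plane[OF assms] by (rule standard_basis)
  have L: "\<Lambda> (automorphy \<gamma> \<tau> * 1, automorphy \<gamma> \<tau> * moebius \<gamma> \<tau>) = \<Lambda> (1, \<tau>)"
    using period_lattice_act[OF assms(1), of "(1, \<tau>)"] by (simp only: basis_act_standard[OF j])
  have scale: "eta (\<Lambda> (1, moebius \<gamma> \<tau>)) \<omega> = automorphy \<gamma> \<tau> * eta (\<Lambda> (1, \<tau>)) (automorphy \<gamma> \<tau> * \<omega>)"
    if "\<omega> \<in> \<Lambda> (1, moebius \<gamma> \<tau>)" for \<omega>
    using eta_scale[OF b that j] j unfolding L by simp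
  have lin: "eta (\<Lambda> (1, \<tau>)) (of_int m + of_int n * \<tau>) = of_int m * eta1 \<tau> + of_int n * eta2 \<tau>" for m n
    using eta_combination[OF standard_basis[OF assms(2)], of m n] by (simp add: eta1_def eta2_def)
  have "automorphy \<gamma> \<tau> * 1 = of_int (\<gamma>$2$2) + of_int (\<gamma>$2$1) * \<tau>"
    by (simp add: automorphy_def)
  then show "eta1 (moebius \<gamma> \<tau>) = automorphy \<gamma> \<tau> * (of_int (\<gamma>$2$1) * eta2 \<tau> + of_int (\<gamma>$2$2) * eta1 \<tau>)"
    using scale[of 1] generators_in_lattice[of "(1, moebius \<gamma> \<tau>)"] lin[of "\<gamma>$2$2" "\<gamma>$2$1"]
    by (simp add: eta1_def[of "moebius \<gamma> \<tau>"])
  have "automorphy \<gamma> \<tau> * moebius \<gamma> \<tau> = of_int (\<gamma>$1$2) + of_int (\<gamma>$1$1) * \<tau>"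
    using j by (simp add: moebius_def)
  then show "eta2 (moebius \<gamma> \<tau>) = automorphy \<gamma> \<tau> * (of_int (\<gamma>$1$1) * eta2 \<tau> + of_int (\<gamma>$1$2) * eta1 \<tau>)"
    using scale[of "moebius \<gamma> \<tau>"] generators_in_lattice[of "(1, moebius \<gamma> \<tau>)"] lin[of "\<gamma>$1$2" "\<gamma>$1$1"]
    by (simp add: eta2_def[of "moebius \<gamma> \<tau>"])
qed

context
  fixes \<Gamma> :: "(int^2^2) set"
  assumes \<Gamma>: "subgroup \<Gamma> SL2Z"
begin

lemma subgroup_det: "\<gamma> \<in> \<Gamma> \<Longrightarrow> det \<gamma> = 1"
  using subgroup.subset[OF \<Gamma>] by (auto simp: SL2Z_def)

lemma subgroup_mat_1: "mat 1 \<in> \<Gamma>"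
  using subgroup.one_closed[OF \<Gamma>] by (simp add: SL2Z_def)

lemma subgroup_mult: "\<gamma> \<in> \<Gamma> \<Longrightarrow> \<delta> \<in> \<Gamma> \<Longrightarrow> \<gamma> ** \<delta> \<in> \<Gamma>"
  using subgroup.m_closed[OF \<Gamma>] by (simp add: SL2Z_def)

lemma subgroup_adjugate:
  assumes "\<gamma> \<in> \<Gamma>"
  shows "adjugate \<gamma> \<in> \<Gamma>"
proof -
  have "inv\<^bsub>SL2Z\<^esub> \<gamma> = adjugate \<gamma>"
    using subgroup_det[OF assms]
    by (intro group.inv_equality[OF group_SL2Z]) (simp_all add: SL2Z_def adjugate_mult det_adjugate)
  then show ?thesis using subgroup.m_inv_closed[OF \<Gamma> assms] by simp
qed

lemma basis_in_class: "p \<in> basis_class \<Gamma> p"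
  unfolding basis_class_def using subgroup_mat_1 basis_act_one by (metis image_eqI)

lemma basis_class_act:
  assumes "\<gamma> \<in> \<Gamma>"
  shows "basis_class \<Gamma> (basis_act \<gamma> p) = basis_class \<Gamma> p"
proof -
  have sub: "basis_class \<Gamma> (basis_act \<delta> q) \<subseteq> basis_class \<Gamma> q" if "\<delta> \<in> \<Gamma>" for \<delta> q
    using subgroup_mult[OF _ that] by (auto simp: basis_class_def simp flip: basis_act_mult)
  have "p = basis_act (adjugate \<gamma>) (basis_act \<gamma> p)"
    using subgroup_det[OF assms] by (simp add: adjugate_mult basis_act_one flip: basis_act_mult)
  then show ?thesis using sub[OF assms, of p] sub[OF subgroup_adjugate[OF assms], of "basis_act \<gamma> p"] by simp
qed

lemma basis_class_lattice:
  assumes "q \<in> basis_class \<Gamma> p"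
  shows "\<Lambda> q = \<Lambda> p"
proof -
  obtain \<gamma> where "\<gamma> \<in> \<Gamma>" "q = basis_act \<gamma> p" using assms by (auto simp only: basis_class_def)
  then show ?thesis by (simp only: period_lattice_act[OF subgroup_det])
qed

text \<open>The classes belonging to \<tau> and to \<open>moebius \<gamma> \<tau>\<close> are
  multiples of each other; homogeneity of an elliptic zeta function thereby becomes a transformation
  law in \<tau>.\<close>

lemma basis_class_moebius:
  assumes "\<gamma> \<in> \<Gamma>" "Im \<tau> > 0"
  shows "basis_class \<Gamma> (1, \<tau>) = scale_class (automorphy \<gamma> \<tau>) (basis_class \<Gamma> (1, moebius \<gamma> \<tau>))"
  using basis_class_act[OF assms(1), of "(1, \<tau>)"]
  unfolding basis_act_standard[OF automorphy_nonzero[OF subgroup_det[OF assms(1)] assms(2)]] scale_basis_class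
  by simp

lemma basis_class_in_Omega: "p \<in> bases \<Longrightarrow> basis_class \<Gamma> p \<in> \<Omega> \<Gamma>"
  by (simp add: Omega_def)

end

section \<open>Quasi-periods of elliptic zeta functions\<close>

lemma has_quasi_period_unique:
  assumes "has_quasi_period Z C \<omega> h" "has_quasi_period Z C \<omega> h'" "\<not> polar_class Z C"
  shows "h = h'"
proof -
  obtain z w where z: "Z C z = Some w" using assms(3) by (auto simp: polar_class_def)
  have "map_option (\<lambda>w. w + h) (Z C z) = map_option (\<lambda>w. w + h') (Z C z)"
    using assms(1,2) unfolding has_quasi_period_def by metis
  then show ?thesis by (simp add: z)
qed

lemma quasi_period_eqI:
  assumes "has_quasi_period Z C \<omega> h" "\<not> polar_class Z C"
  shows "quasi_period Z C \<omega> = h"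
  unfolding quasi_period_def using assms has_quasi_period_unique by blast

lemma has_quasi_period_add:
  assumes "has_quasi_period Z C \<omega> h" "has_quasi_period Z C \<omega>' h'"
  shows "has_quasi_period Z C (\<omega> + \<omega>') (h + h')"
proof -
  have "Z C (z + \<omega> + \<omega>') = map_option (\<lambda>w. w + h') (map_option (\<lambda>w. w + h) (Z C z))" for z
    using assms by (simp add: has_quasi_period_def)
  also have "map_option (\<lambda>w. w + h') (map_option (\<lambda>w. w + h) (Z C z)) = map_option (\<lambda>w. w + (h + h')) (Z C z)" for z
    by (simp add: option.map_comp o_def add.assoc)
  finally have "Z C (z + (\<omega> + \<omega>')) = map_option (\<lambda>w. w + (h + h')) (Z C z)" for z
    by (simp only: add.assoc)
  then show ?thesis by (simp add: has_quasi_period_def)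
qed

context
  fixes \<Gamma> :: "(int^2^2) set" and k :: int and Z :: zeta_fun
  assumes \<Gamma>: "subgroup \<Gamma> SL2Z" and Z: "elliptic_zeta \<Gamma> k Z"
begin

lemma elliptic_zeta_quasi_period:
  assumes "p \<in> bases" "\<omega> \<in> \<Lambda> p" "\<not> polar_class Z (basis_class \<Gamma> p)"
  shows "has_quasi_period Z (basis_class \<Gamma> p) \<omega> (quasi_period Z (basis_class \<Gamma> p) \<omega>)"
  using Z assms quasi_period_eqI unfolding elliptic_zeta_def by metis

lemma elliptic_zeta_quasi_period_combination:
  assumes p: "p \<in> bases" "\<not> polar_class Z (basis_class \<Gamma> p)"
  shows "quasi_period Z (basis_class \<Gamma> p) (of_int m * fst p + of_int n * snd p) =
    of_int m * quasi_period Z (basis_class \<Gamma> p) (fst p) + of_int n * quasi_period Z (basis_class \<Gamma> p) (snd p)"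
proof (rule additive_on_lattice)
  fix x y assume "x \<in> \<Lambda> p" "y \<in> \<Lambda> p"
  then show "quasi_period Z (basis_class \<Gamma> p) (x + y) =
      quasi_period Z (basis_class \<Gamma> p) x + quasi_period Z (basis_class \<Gamma> p) y"
    using elliptic_zeta_quasi_period p by (intro quasi_period_eqI has_quasi_period_add)
qed

lemma elliptic_zeta_scale:
  "\<alpha> \<noteq> 0 \<Longrightarrow> C \<in> \<Omega> \<Gamma> \<Longrightarrow> Z (scale_class \<alpha> C) (\<alpha> * z) = map_option (\<lambda>w. \<alpha> powi k * w) (Z C z)"
  using Z by (simp add: elliptic_zeta_def)

lemma polar_class_scale:
  assumes "\<alpha> \<noteq> 0" "C \<in> \<Omega> \<Gamma>"
  shows "polar_class Z (scale_class \<alpha> C) \<longleftrightarrow> polar_class Z C"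
proof
  assume "polar_class Z (scale_class \<alpha> C)"
  then show "polar_class Z C" using elliptic_zeta_scale[OF assms] by (simp add: polar_class_def)
next
  assume "polar_class Z C"
  then have "Z (scale_class \<alpha> C) (\<alpha> * (z / \<alpha>)) = None" for z
    by (subst elliptic_zeta_scale[OF assms]) (simp add: polar_class_def)
  then show "polar_class Z (scale_class \<alpha> C)" using assms by (simp add: polar_class_def)
qed

lemma quasi_period_scale:
  assumes p: "p \<in> bases" "\<omega> \<in> \<Lambda> p" and \<alpha>: "\<alpha> \<noteq> 0" and np: "\<not> polar_class Z (basis_class \<Gamma> p)"
  shows "quasi_period Z (scale_class \<alpha> (basis_class \<Gamma> p)) (\<alpha> * \<omega>) = \<alpha> powi k * quasi_period Z (basis_class \<Gamma> p) \<omega>"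
proof (rule quasi_period_eqI)
  have O: "basis_class \<Gamma> p \<in> \<Omega> \<Gamma>" using basis_class_in_Omega[OF \<Gamma>] p by blast
  show "\<not> polar_class Z (scale_class \<alpha> (basis_class \<Gamma> p))" using polar_class_scale[OF \<alpha> O] np by simp
  show "has_quasi_period Z (scale_class \<alpha> (basis_class \<Gamma> p)) (\<alpha> * \<omega>) (\<alpha> powi k * quasi_period Z (basis_class \<Gamma> p) \<omega>)"
    unfolding has_quasi_period_def
  proof
    fix z
    have "Z (scale_class \<alpha> (basis_class \<Gamma> p)) (\<alpha> * (z / \<alpha> + \<omega>)) =
        map_option (\<lambda>w. w + \<alpha> powi k * quasi_period Z (basis_class \<Gamma> p) \<omega>)
          (Z (scale_class \<alpha> (basis_class \<Gamma> p)) (\<alpha> * (z / \<alpha>)))"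
      using elliptic_zeta_quasi_period[OF p np] unfolding has_quasi_period_def elliptic_zeta_scale[OF \<alpha> O]
      by (simp add: option.map_comp o_def distrib_left)
    then show "Z (scale_class \<alpha> (basis_class \<Gamma> p)) (z + \<alpha> * \<omega>) =
        map_option (\<lambda>w. w + \<alpha> powi k * quasi_period Z (basis_class \<Gamma> p) \<omega>)
          (Z (scale_class \<alpha> (basis_class \<Gamma> p)) z)"
      using \<alpha> by (simp add: distrib_left)
  qed
qed

lemma polar_class_moebius:
  assumes "\<gamma> \<in> \<Gamma>" "Im \<tau> > 0"
  shows "polar_class Z (basis_class \<Gamma> (1, moebius \<gamma> \<tau>)) \<longleftrightarrow> polar_class Z (basis_class \<Gamma> (1, \<tau>))"
proof -
  have d: "det \<gamma> = 1" using subgroup_det[OF \<Gamma>] assms by blast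
  have "basis_class \<Gamma> (1, moebius \<gamma> \<tau>) \<in> \<Omega> \<Gamma>"
    using basis_class_in_Omega[OF \<Gamma> standard_basis[OF moebius_upper_half_plane[OF d assms(2)]]] .
  from polar_class_scale[OF automorphy_nonzero[OF d assms(2)] this]
  show ?thesis using basis_class_moebius[OF \<Gamma> assms] by simp
qed

text \<open>Homogeneity relates the quasi-period of \<omega> for
  \<open>moebius \<gamma> \<tau>\<close> to that of (c \<tau> + d) \<omega> for \<tau>; for \<omega>
  among the generators the latter is an integral combination of 1 and \<tau>. For k = -1 the law has
  the shape of \<open>eta_moebius\<close>.\<close>

lemma quasi_period_moebius:
  fixes \<tau> :: complex
  defines "q \<equiv> \<lambda>\<tau>. quasi_period Z (basis_class \<Gamma> (1, \<tau>))"
  assumes "\<gamma> \<in> \<Gamma>" "Im \<tau> > 0" "\<not> polar_class Z (basis_class \<Gamma> (1, \<tau>))"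
  shows "automorphy \<gamma> \<tau> powi k * q (moebius \<gamma> \<tau>) 1 = of_int (\<gamma>$2$1) * q \<tau> \<tau> + of_int (\<gamma>$2$2) * q \<tau> 1"
    and "automorphy \<gamma> \<tau> powi k * q (moebius \<gamma> \<tau>) (moebius \<gamma> \<tau>) = of_int (\<gamma>$1$1) * q \<tau> \<tau> + of_int (\<gamma>$1$2) * q \<tau> 1"
proof -
  let ?p = "(1, moebius \<gamma> \<tau>)"
  have d: "det \<gamma> = 1" using subgroup_det[OF \<Gamma>] assms by blast
  have j: "automorphy \<gamma> \<tau> \<noteq> 0" using automorphy_nonzero[OF d assms(3)] .
  have p: "?p \<in> bases" using standard_basis[OF moebius_upper_half_plane[OF d assms(3)]] .
  have np: "\<not> polar_class Z (basis_class \<Gamma> ?p)" using polar_class_moebius assms by blast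
  have scale: "q \<tau> (automorphy \<gamma> \<tau> * \<omega>) = automorphy \<gamma> \<tau> powi k * q (moebius \<gamma> \<tau>) \<omega>" if "\<omega> \<in> \<Lambda> ?p" for \<omega>
    using quasi_period_scale[OF p that j np] by (simp add: q_def basis_class_moebius[OF \<Gamma> assms(2,3)])
  have lin: "q \<tau> (of_int m + of_int n * \<tau>) = of_int m * q \<tau> 1 + of_int n * q \<tau> \<tau>" for m n
    using elliptic_zeta_quasi_period_combination[OF standard_basis[OF assms(3)] assms(4), of m n] by (simp add: q_def)
  have gen: "1 \<in> \<Lambda> ?p" "moebius \<gamma> \<tau> \<in> \<Lambda> ?p" using generators_in_lattice[of ?p] by simp_all
  have e1: "automorphy \<gamma> \<tau> * 1 = of_int (\<gamma>$2$2) + of_int (\<gamma>$2$1) * \<tau>"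
    by (simp add: automorphy_def)
  show "automorphy \<gamma> \<tau> powi k * q (moebius \<gamma> \<tau>) 1 = of_int (\<gamma>$2$1) * q \<tau> \<tau> + of_int (\<gamma>$2$2) * q \<tau> 1"
    using scale[OF gen(1), unfolded e1 lin] by (metis add.commute)
  have e2: "automorphy \<gamma> \<tau> * moebius \<gamma> \<tau> = of_int (\<gamma>$1$2) + of_int (\<gamma>$1$1) * \<tau>"
    using j by (simp add: moebius_def)
  show "automorphy \<gamma> \<tau> powi k * q (moebius \<gamma> \<tau>) (moebius \<gamma> \<tau>) = of_int (\<gamma>$1$1) * q \<tau> \<tau> + of_int (\<gamma>$1$2) * q \<tau> 1"
    using scale[OF gen(2), unfolded e2 lin] by (metis add.commute)
qed

text \<open>Cramer's rule for the two equations at \<omega> = 1 and \<omega> = \<tau>. Linearity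
  extends the solution to the lattice, and all representatives of the class span that same
  lattice.\<close>

lemma Phi_Psi_eq:
  fixes \<tau> :: complex
  defines "q \<equiv> quasi_period Z (basis_class \<Gamma> (1, \<tau>))"
  assumes t: "Im \<tau> > 0" and np: "\<not> polar_class Z (basis_class \<Gamma> (1, \<tau>))"
  shows "Phi Z (basis_class \<Gamma> (1, \<tau>)) = (q \<tau> * eta1 \<tau> - q 1 * eta2 \<tau>) / (\<tau> * eta1 \<tau> - eta2 \<tau>)" (is "_ = ?\<phi>")
    and "Psi Z (basis_class \<Gamma> (1, \<tau>)) = (\<tau> * q 1 - q \<tau>) / (\<tau> * eta1 \<tau> - eta2 \<tau>)" (is "_ = ?\<psi>")
proof -
  let ?C = "basis_class \<Gamma> (1, \<tau>)" and ?W = "\<tau> * eta1 \<tau> - eta2 \<tau>"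
  have W: "?W \<noteq> 0" by (rule eta_determinant_nonzero[OF t])
  have lin: "q (of_int m + of_int n * \<tau>) = of_int m * q 1 + of_int n * q \<tau>" for m n
    using elliptic_zeta_quasi_period_combination[OF standard_basis[OF t] np, of m n] by (simp add: q_def)
  have eta_lin: "eta (\<Lambda> (1, \<tau>)) (of_int m + of_int n * \<tau>) = of_int m * eta1 \<tau> + of_int n * eta2 \<tau>" for m n
    using eta_combination[OF standard_basis[OF t], of m n] by (simp add: eta1_def eta2_def)
  have "Phi_Psi Z ?C = (?\<phi>, ?\<psi>)"
    unfolding Phi_Psi_def
  proof (rule the_equality)
    have "?\<phi> + ?\<psi> * eta1 \<tau> = ((q \<tau> * eta1 \<tau> - q 1 * eta2 \<tau>) + (\<tau> * q 1 - q \<tau>) * eta1 \<tau>) / ?W"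
      by (simp add: add_divide_distrib)
    also have "(q \<tau> * eta1 \<tau> - q 1 * eta2 \<tau>) + (\<tau> * q 1 - q \<tau>) * eta1 \<tau> = q 1 * ?W" by algebra
    finally have 1: "?\<phi> + ?\<psi> * eta1 \<tau> = q 1" using W by simp
    have "?\<phi> * \<tau> + ?\<psi> * eta2 \<tau> = ((q \<tau> * eta1 \<tau> - q 1 * eta2 \<tau>) * \<tau> + (\<tau> * q 1 - q \<tau>) * eta2 \<tau>) / ?W"
      by (simp add: add_divide_distrib)
    also have "(q \<tau> * eta1 \<tau> - q 1 * eta2 \<tau>) * \<tau> + (\<tau> * q 1 - q \<tau>) * eta2 \<tau> = q \<tau> * ?W" by algebra
    finally have 2: "?\<phi> * \<tau> + ?\<psi> * eta2 \<tau> = q \<tau>" using W by simp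
    have "quasi_period Z ?C \<omega> = ?\<phi> * \<omega> + ?\<psi> * eta (\<Lambda> p) \<omega>" if p: "p \<in> ?C" and "\<omega> \<in> \<Lambda> p" for p \<omega>
    proof -
      have L: "\<Lambda> p = \<Lambda> (1, \<tau>)" using basis_class_lattice[OF \<Gamma> p] .
      have "\<omega> \<in> \<Lambda> (1, \<tau>)" using that L by simp
      then obtain m n where \<omega>: "\<omega> = of_int m + of_int n * \<tau>"
        by (auto simp: period_lattice_def)
      have "q \<omega> = of_int m * (?\<phi> + ?\<psi> * eta1 \<tau>) + of_int n * (?\<phi> * \<tau> + ?\<psi> * eta2 \<tau>)"
        unfolding \<omega> lin 1 2 ..
      also have "\<dots> = ?\<phi> * \<omega> + ?\<psi> * eta (\<Lambda> p) \<omega>"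
        unfolding L \<omega> eta_lin by (simp only: algebra_simps)
      finally show ?thesis by (simp only: q_def)
    qed
    then show "case (?\<phi>, ?\<psi>) of (\<phi>, \<psi>) \<Rightarrow> \<forall>p\<in>?C. \<forall>\<omega>\<in>\<Lambda> p. quasi_period Z ?C \<omega> = \<phi> * \<omega> + \<psi> * eta (\<Lambda> p) \<omega>"
      by simp
  next
    fix x :: "complex \<times> complex"
    obtain \<phi> \<psi> where x: "x = (\<phi>, \<psi>)" by (cases x)
    assume "case x of (\<phi>, \<psi>) \<Rightarrow> \<forall>p\<in>?C. \<forall>\<omega>\<in>\<Lambda> p. quasi_period Z ?C \<omega> = \<phi> * \<omega> + \<psi> * eta (\<Lambda> p) \<omega>"
    then have "q \<omega> = \<phi> * \<omega> + \<psi> * eta (\<Lambda> (1, \<tau>)) \<omega>" if "\<omega> \<in> \<Lambda> (1, \<tau>)" for \<omega>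
      using that basis_in_class[OF \<Gamma>, of "(1, \<tau>)"] by (simp add: x q_def)
    from this[of 1] this[of \<tau>] generators_in_lattice[of "(1, \<tau>)"]
    have "q 1 = \<phi> + \<psi> * eta1 \<tau>" "q \<tau> = \<phi> * \<tau> + \<psi> * eta2 \<tau>"
      by (simp_all add: eta1_def eta2_def)
    then have "\<phi> * ?W = q \<tau> * eta1 \<tau> - q 1 * eta2 \<tau>" "\<psi> * ?W = \<tau> * q 1 - q \<tau>"
      by (simp_all add: algebra_simps)
    then show "x = (?\<phi>, ?\<psi>)" using W by (simp add: x eq_divide_eq)
  qed
  then show "Phi Z ?C = ?\<phi>" "Psi Z ?C = ?\<psi>" by (simp_all add: Phi_def Psi_def)
qed

end

section \<open>Meromorphic functions with values in the sphere\<close>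

lemma open_H: "open \<H>"
  unfolding upper_half_plane_def by (rule open_halfspace_Im_gt)

lemma connected_H: "connected \<H>"
  unfolding upper_half_plane_def by (intro convex_connected convex_halfspace_Im_gt)

lemma eventually_in_H: "\<tau> \<in> \<H> \<Longrightarrow> \<forall>\<^sub>F w in at \<tau>. w \<in> \<H>"
  by (rule eventually_at_in_open'[OF open_H])

lemma eventually_moebius:
  assumes "\<forall>\<tau>\<in>\<H>. \<forall>\<^sub>F w in at \<tau>. P w" "det \<gamma> = 1" "\<tau> \<in> \<H>"
  shows "\<forall>\<^sub>F w in at \<tau>. P (moebius \<gamma> w)"
  using filterlim_moebius[OF assms(2,3)] assms(1) moebius_in_H[OF assms(2,3)]
  unfolding filterlim_iff by blast

lemma nicely_meromorphic_on_cong_open: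
  assumes "open A" "\<And>z. z \<in> A \<Longrightarrow> f z = g z" "g nicely_meromorphic_on A"
  shows "f nicely_meromorphic_on A"
proof -
  have ev: "\<forall>\<^sub>F w in at z. f w = g w" if "z \<in> A" for z
    using eventually_at_in_open'[OF assms(1) that] by eventually_elim (rule assms(2))
  have "f meromorphic_on A"
    using assms(3) ev meromorphic_on_cong[of A f g A] by (simp add: nicely_meromorphic_on_def)
  moreover have "is_pole f z \<longleftrightarrow> is_pole g z" if "z \<in> A" for z
    using ev[OF that] by (intro is_pole_cong) auto
  moreover have "(f \<longlongrightarrow> c) (at z) \<longleftrightarrow> (g \<longlongrightarrow> c) (at z)" if "z \<in> A" for z c
    using ev[OF that] by (rule tendsto_cong)
  ultimately show ?thesis using assms(2,3) by (simp add: nicely_meromorphic_on_def)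
qed

lemma mero_of_nicely_meromorphic:
  assumes "f meromorphic_on \<H>"
  shows "mero_of f nicely_meromorphic_on \<H>"
  by (rule nicely_meromorphic_on_cong_open[OF open_H _ remove_sings_nicely_meromorphic[OF assms]])
    (simp add: mero_of_def)

lemma mero_of_extensional: "mero_of f \<in> extensional \<H>"
  by (simp add: mero_of_def)

lemma eventually_mero_of:
  assumes "f meromorphic_on \<H>" "\<tau> \<in> \<H>"
  shows "\<forall>\<^sub>F w in at \<tau>. mero_of f w = f w"
  using eventually_cosparse_imp_eventually_at[OF eventually_remove_sings_eq[OF assms(1)] assms(2)]
    eventually_in_H[OF assms(2)]
  by eventually_elim (simp add: mero_of_def)

text \<open>Removing singularities looks only at punctured neighbourhoods. Hence equalities between
  the three maps may be checked away from poles and zeros of denominators.\<close>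

lemma mero_of_cong:
  assumes "\<And>\<tau>. \<tau> \<in> \<H> \<Longrightarrow> \<forall>\<^sub>F w in at \<tau>. f w = g w"
  shows "mero_of f = mero_of g"
  unfolding mero_of_def using assms by (intro restrict_ext remove_sings_cong) auto

lemma mero_of_id:
  assumes "f nicely_meromorphic_on \<H>" "f \<in> extensional \<H>"
  shows "mero_of f = f"
proof
  fix z
  show "mero_of f z = f z"
  proof (cases "z \<in> \<H>")
    case True
    then have "is_pole f z \<and> f z = 0 \<or> (f \<longlongrightarrow> f z) (at z)"
      using assms(1) by (auto simp: nicely_meromorphic_on_def)
    then show ?thesis using True by (auto simp: mero_of_def)
  qed (use assms(2) in \<open>simp add: mero_of_def extensional_def\<close>)
qed

lemma nicely_meromorphic_eqI:
  assumes "f nicely_meromorphic_on \<H>" "f \<in> extensional \<H>" "g nicely_meromorphic_on \<H>" "g \<in> extensional \<H>"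
    and "\<And>\<tau>. \<tau> \<in> \<H> \<Longrightarrow> \<forall>\<^sub>F w in at \<tau>. f w = g w"
  shows "f = g"
  using mero_of_cong[OF assms(5)] mero_of_id assms by metis

text \<open>The identity theorem on the connected set \<open>\<H>\<close>: a failure of
  non-vanishing near one point spreads to all of \<open>\<H>\<close>.\<close>

lemma meromorphic_zero_or_eventually_nonzero:
  assumes "f meromorphic_on \<H>"
  shows "(\<forall>\<tau>\<in>\<H>. \<forall>\<^sub>F w in at \<tau>. f w = 0) \<or> (\<forall>\<tau>\<in>\<H>. \<forall>\<^sub>F w in at \<tau>. f w \<noteq> 0)"
  using meromorphic_imp_constant_or_avoid[OF assms open_H connected_H, of 0]
  by (simp add: eventually_cosparse_open_eq[OF open_H])

lemma eventually_not_pole: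
  assumes "f meromorphic_on \<H>" "\<tau> \<in> \<H>"
  shows "\<forall>\<^sub>F w in at \<tau>. \<not> is_pole f w"
  using eventually_cosparse_imp_eventually_at[OF meromorphic_on_imp_not_pole_cosparse[OF assms(1)] assms(2)] .

text \<open>Convergence in the Riemann sphere. One notion for finite limits and poles makes both
  cases consequences of uniqueness of limits.\<close>

definition sphere_lim :: "(complex \<Rightarrow> complex) \<Rightarrow> complex option \<Rightarrow> complex \<Rightarrow> bool" where
  "sphere_lim f v z = (case v of None \<Rightarrow> filterlim f at_infinity (at z) | Some w \<Rightarrow> (f \<longlongrightarrow> w) (at z))"

lemma sphere_lim_unique: "sphere_lim f v z \<Longrightarrow> sphere_lim f v' z \<Longrightarrow> v = v'"
  by (auto simp: sphere_lim_def split: option.splits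
      dest: LIM_unique not_tendsto_and_filterlim_at_infinity[OF at_neq_bot])

lemma sphere_lim_cong: "\<forall>\<^sub>F w in at z. f w = g w \<Longrightarrow> sphere_lim f v z \<longleftrightarrow> sphere_lim g v z"
  by (auto simp: sphere_lim_def filterlim_cong split: option.split)

lemma sphere_lim_sphere_val:
  assumes "f nicely_meromorphic_on A" "z \<in> A"
  shows "sphere_lim f (sphere_val f z) z"
  using assms by (auto simp: sphere_lim_def sphere_val_def nicely_meromorphic_on_def is_pole_def)

lemma nicely_meromorphic_eq_sphere_val:
  assumes "f nicely_meromorphic_on A" "z \<in> A"
  shows "f z = (case sphere_val f z of None \<Rightarrow> 0 | Some w \<Rightarrow> w)"
  using assms is_pole_zero_at_nicely_mero[of f A z] by (auto simp: sphere_val_def)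

lemma sphere_lim_moebius_compose:
  assumes "f nicely_meromorphic_on \<H>" "det \<gamma> = 1" "\<tau> \<in> \<H>"
  shows "sphere_lim (\<lambda>w. f (moebius \<gamma> w)) (sphere_val f (moebius \<gamma> \<tau>)) \<tau>"
  using sphere_lim_sphere_val[OF assms(1) moebius_in_H[OF assms(2,3)]] filterlim_moebius[OF assms(2,3)]
  by (auto simp: sphere_lim_def split: option.splits intro: filterlim_compose)

text \<open>Both sides are limits in the sphere of one function at \<tau>: the factor (c w + d)^2
  tends to a nonzero number, so it preserves poles and rescales finite values.\<close>

lemma sphere_val_moebius_weight_2:
  assumes f: "f nicely_meromorphic_on \<H>" and \<gamma>: "det \<gamma> = 1" and \<tau>: "\<tau> \<in> \<H>"
    and ev: "\<forall>\<^sub>F w in at \<tau>. f (moebius \<gamma> w) = automorphy \<gamma> w ^ 2 * f w"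
  shows "sphere_val f (moebius \<gamma> \<tau>) = map_option (\<lambda>w. automorphy \<gamma> \<tau> ^ 2 * w) (sphere_val f \<tau>)"
proof -
  have j: "automorphy \<gamma> \<tau> ^ 2 \<noteq> 0" using automorphy_nonzero[OF \<gamma>] \<tau> by (simp add: upper_half_plane_def)
  have lim: "((\<lambda>w. automorphy \<gamma> w ^ 2) \<longlongrightarrow> automorphy \<gamma> \<tau> ^ 2) (at \<tau>)"
    unfolding automorphy_def by (intro tendsto_intros)
  have "sphere_lim (\<lambda>w. automorphy \<gamma> w ^ 2 * f w) (map_option (\<lambda>w. automorphy \<gamma> \<tau> ^ 2 * w) (sphere_val f \<tau>)) \<tau>"
    using sphere_lim_sphere_val[OF f \<tau>] lim j
    by (auto simp: sphere_lim_def split: option.splits intro: tendsto_mult tendsto_mult_filterlim_at_infinity)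
  moreover have "sphere_lim (\<lambda>w. automorphy \<gamma> w ^ 2 * f w) (sphere_val f (moebius \<gamma> \<tau>)) \<tau>"
    using sphere_lim_moebius_compose[OF f \<gamma> \<tau>] sphere_lim_cong[OF ev] by simp
  ultimately show ?thesis by (rule sphere_lim_unique[symmetric])
qed

text \<open>Passes from a punctured neighbourhood to the point itself. If \<tau> is a pole, so is
  its image, and the normal form stores 0 at both.\<close>

lemma weight_2_everywhere:
  assumes f: "f nicely_meromorphic_on \<H>" and \<gamma>: "det \<gamma> = 1" and \<tau>: "\<tau> \<in> \<H>"
    and ev: "\<forall>\<^sub>F w in at \<tau>. f (moebius \<gamma> w) = automorphy \<gamma> w ^ 2 * f w"
  shows "f (moebius \<gamma> \<tau>) = automorphy \<gamma> \<tau> ^ 2 * f \<tau>"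
  using sphere_val_moebius_weight_2[OF assms] nicely_meromorphic_eq_sphere_val[OF f \<tau>]
    nicely_meromorphic_eq_sphere_val[OF f moebius_in_H[OF \<gamma> \<tau>]]
  by (simp split: option.splits)

text \<open>Continuity of a Moebius transformation on the sphere. The condition on
  \<open>automorphy\<close> keeps the quotient near \<tau> from being a division by zero, as it
  would be for h constantly -d / c.\<close>

lemma sphere_lim_moebius_sphere:
  assumes \<gamma>: "det \<gamma> = 1" and v: "sphere_lim h v \<tau>"
    and ev: "\<forall>\<^sub>F w in at \<tau>. automorphy \<gamma> (h w) \<noteq> 0"
  shows "sphere_lim (\<lambda>w. moebius \<gamma> (h w)) (moebius_sphere \<gamma> v) \<tau>"
proof -
  let ?a = "of_int (\<gamma>$1$1) :: complex" and ?b = "of_int (\<gamma>$1$2) :: complex"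
  let ?c = "of_int (\<gamma>$2$1) :: complex" and ?d = "of_int (\<gamma>$2$2) :: complex"
  have det: "?a * ?d - ?b * ?c = 1" using det_one_entries(2)[OF \<gamma>] .
  show ?thesis
  proof (cases v)
    case (Some w)
    then have lim: "(h \<longlongrightarrow> w) (at \<tau>)" using v by (simp add: sphere_lim_def)
    have den: "((\<lambda>x. automorphy \<gamma> (h x)) \<longlongrightarrow> automorphy \<gamma> w) (at \<tau>)"
      unfolding automorphy_def by (intro tendsto_intros lim)
    have num: "((\<lambda>x. ?a * h x + ?b) \<longlongrightarrow> ?a * w + ?b) (at \<tau>)"
      by (intro tendsto_intros lim)
    show ?thesis
    proof (cases "automorphy \<gamma> w = 0")
      case False
      then show ?thesis
        using tendsto_divide[OF num den] by (simp add: Some sphere_lim_def moebius_def)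
    next
      case True
      \<comment> \<open>Numerator and denominator have no common zero because the determinant is 1,
        so the quotient really tends to infinity.\<close>
      have "?a * w + ?b \<noteq> 0"
      proof
        assume "?a * w + ?b = 0"
        then show False using det True unfolding automorphy_def by algebra
      qed
      moreover have "filterlim (\<lambda>x. automorphy \<gamma> (h x)) (at 0) (at \<tau>)"
        using den ev True by (simp add: filterlim_at)
      ultimately have "filterlim (\<lambda>x. (?a * h x + ?b) / automorphy \<gamma> (h x)) at_infinity (at \<tau>)"
        using num by (intro filterlim_divide_at_infinity)
      then show ?thesis using True by (simp add: Some sphere_lim_def moebius_def)
    qed
  next
    case None
    then have lim: "filterlim h at_infinity (at \<tau>)" using v by (simp add: sphere_lim_def)
    have affine: "filterlim (\<lambda>x. r * h x + s) at_infinity (at \<tau>)" if "r \<noteq> 0" for r s :: complex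
    proof -
      have "filterlim (\<lambda>x. r * h x) at_infinity (at \<tau>)"
        using tendsto_mult_filterlim_at_infinity[OF tendsto_const that lim] .
      from tendsto_add_filterlim_at_infinity'[OF this tendsto_const] show ?thesis .
    qed
    show ?thesis
    proof (cases "\<gamma>$2$1 = 0")
      case True
      then have "?a / ?d \<noteq> 0" "?d \<noteq> 0" using det by auto
      moreover have "moebius \<gamma> z = ?a / ?d * z + ?b / ?d" for z
        using True by (simp add: moebius_def automorphy_def add_divide_distrib)
      ultimately show ?thesis using affine[of "?a / ?d" "?b / ?d"] True by (simp add: None sphere_lim_def)
    next
      case False
      then have "filterlim (\<lambda>x. automorphy \<gamma> (h x)) at_infinity (at \<tau>)"
        unfolding automorphy_def by (intro affine) simp
      from filterlim_compose[OF tendsto_inverse_0 this]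
      \<comment> \<open>By the determinant condition (a h + b) / (c h + d) = a / c - 1 / (c (c h +
        d)), and the last term vanishes as h tends to infinity.\<close>
      have "((\<lambda>x. ?a / ?c - inverse (automorphy \<gamma> (h x)) / ?c) \<longlongrightarrow> ?a / ?c - 0 / ?c) (at \<tau>)"
        using False by (intro tendsto_intros) auto
      moreover have "\<forall>\<^sub>F x in at \<tau>. ?a / ?c - inverse (automorphy \<gamma> (h x)) / ?c = moebius \<gamma> (h x)"
        using ev
      proof eventually_elim
        case (elim x)
        have "?a * automorphy \<gamma> (h x) - 1 = ?c * (?a * h x + ?b)"
          unfolding automorphy_def using det by algebra
        then have "(?a * automorphy \<gamma> (h x) - 1) / (?c * automorphy \<gamma> (h x)) = moebius \<gamma> (h x)"
          using False elim by (simp add: moebius_def)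
        then show ?case using False elim by (simp add: diff_divide_distrib inverse_eq_divide mult.commute)
      qed
      ultimately have "((\<lambda>x. moebius \<gamma> (h x)) \<longlongrightarrow> ?a / ?c) (at \<tau>)"
        by (simp add: tendsto_cong)
      then show ?thesis using False by (simp add: None sphere_lim_def)
    qed
  qed
qed

text \<open>The counterpart of \<open>weight_2_everywhere\<close> for equivariance: the two sides
  are sphere limits of functions that agree near \<tau>.\<close>

lemma equivariant_everywhere:
  assumes h: "h nicely_meromorphic_on \<H>" and \<gamma>: "det \<gamma> = 1" and \<tau>: "\<tau> \<in> \<H>"
    and ev: "\<forall>\<^sub>F w in at \<tau>. automorphy \<gamma> (h w) \<noteq> 0 \<and> h (moebius \<gamma> w) = moebius \<gamma> (h w)"
  shows "sphere_val h (moebius \<gamma> \<tau>) = moebius_sphere \<gamma> (sphere_val h \<tau>)"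
proof (rule sphere_lim_unique)
  show "sphere_lim (\<lambda>w. h (moebius \<gamma> w)) (sphere_val h (moebius \<gamma> \<tau>)) \<tau>"
    by (rule sphere_lim_moebius_compose[OF h \<gamma> \<tau>])
  have "sphere_lim (\<lambda>w. moebius \<gamma> (h w)) (moebius_sphere \<gamma> (sphere_val h \<tau>)) \<tau>"
    using ev by (intro sphere_lim_moebius_sphere \<gamma> sphere_lim_sphere_val[OF h \<tau>]) (auto elim: eventually_mono)
  moreover have "\<forall>\<^sub>F w in at \<tau>. h (moebius \<gamma> w) = moebius \<gamma> (h w)"
    using ev by (auto elim: eventually_mono)
  ultimately show "sphere_lim (\<lambda>w. h (moebius \<gamma> w)) (moebius_sphere \<gamma> (sphere_val h \<tau>)) \<tau>"
    by (simp add: sphere_lim_cong)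
qed

section \<open>An element with nonzero lower left entry from finite index\<close>

definition lower_unipotent :: "int \<Rightarrow> int^2^2" where
  "lower_unipotent n = vector [vector [1, 0], vector [n, 1]]"

lemma lower_unipotent_mult: "lower_unipotent m ** lower_unipotent n = lower_unipotent (m + n)"
  by (simp add: lower_unipotent_def vec_eq_iff forall_2 matrix_matrix_mult_def sum_2)

text \<open>Pigeonhole: infinitely many lower unipotent matrices meet finitely many cosets, and the
  quotient of two in the same coset is lower unipotent with entry m - n.\<close>

lemma finite_index_lower_left_nonzero:
  fixes \<Gamma> :: "(int^2^2) set"
  assumes \<Gamma>: "subgroup \<Gamma> SL2Z" and fin: "finite (rcosets\<^bsub>SL2Z\<^esub> \<Gamma>)"
  obtains \<gamma> :: "int^2^2" where "\<gamma> \<in> \<Gamma>" "\<gamma>$2$1 \<noteq> 0"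
proof -
  let ?f = "\<lambda>n. \<Gamma> #>\<^bsub>SL2Z\<^esub> lower_unipotent n"
  have "lower_unipotent n \<in> carrier SL2Z" for n
    by (simp add: SL2Z_def det_2 lower_unipotent_def)
  then have "range ?f \<subseteq> rcosets\<^bsub>SL2Z\<^esub> \<Gamma>" by (auto simp: RCOSETS_def)
  then have "finite (range ?f)" using fin finite_subset by blast
  then have "\<not> inj ?f" using finite_imageD infinite_UNIV_int by blast
  then obtain m n where mn: "m \<noteq> n" "?f m = ?f n" by (auto simp: inj_def)
  have "lower_unipotent m \<in> ?f m"
    using subgroup_mat_1[OF \<Gamma>] by (auto simp: r_coset_def SL2Z_def intro!: bexI[of _ "mat 1"])
  then obtain \<gamma> where \<gamma>: "\<gamma> \<in> \<Gamma>" "lower_unipotent m = \<gamma> ** lower_unipotent n"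
    unfolding mn(2) by (auto simp: r_coset_def SL2Z_def)
  have "\<gamma> ** (lower_unipotent n ** lower_unipotent (- n)) = lower_unipotent (m - n)"
    using \<gamma>(2) lower_unipotent_mult[of m "- n"] by (simp add: matrix_mul_assoc)
  moreover have "lower_unipotent 0 = mat 1"
    by (simp add: lower_unipotent_def vec_eq_iff forall_2 mat_def)
  ultimately have "\<gamma> = lower_unipotent (m - n)" by (simp add: lower_unipotent_mult)
  then show thesis using that[of \<gamma>] \<gamma>(1) mn(1) by (simp add: lower_unipotent_def)
qed

section \<open>Modular forms and equivariant functions\<close>

lemma eta_meromorphic: "eta1 meromorphic_on \<H>" "eta2 meromorphic_on \<H>"
  using eta_holomorphic open_H by (simp_all add: analytic_on_imp_meromorphic_on analytic_on_open)

lemma H_iff: "\<tau> \<in> \<H> \<longleftrightarrow> Im \<tau> > 0"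
  by (simp add: upper_half_plane_def)

lemma ii_in_H: "\<i> \<in> \<H>" by (simp add: H_iff)

lemma M2_to_Eq_eta: "M2_to_Eq f = mero_of (\<lambda>\<tau>. (\<tau> * f \<tau> + eta2 \<tau>) / (f \<tau> + eta1 \<tau>))"
  by (simp add: M2_to_Eq_def eta1_def eta2_def)

lemma M2_to_Eq_meromorphic:
  "f meromorphic_on \<H> \<Longrightarrow> (\<lambda>\<tau>. (\<tau> * f \<tau> + eta2 \<tau>) / (f \<tau> + eta1 \<tau>)) meromorphic_on \<H>"
  by (intro meromorphic_intros eta_meromorphic)

lemma M2D:
  assumes "f \<in> M2 \<Gamma>"
  shows "f \<in> extensional \<H>" "f nicely_meromorphic_on \<H>" "f meromorphic_on \<H>"
    "\<And>\<gamma> \<tau>. \<gamma> \<in> \<Gamma> \<Longrightarrow> \<tau> \<in> \<H> \<Longrightarrow> f (moebius \<gamma> \<tau>) = automorphy \<gamma> \<tau> ^ 2 * f \<tau>"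
  using assms by (auto simp: M2_def nicely_meromorphic_on_def)

lemma EqD:
  assumes "h \<in> Eq \<Gamma>"
  shows "h \<in> extensional \<H>" "h nicely_meromorphic_on \<H>" "h meromorphic_on \<H>" "h \<noteq> restrict (\<lambda>\<tau>. \<tau>) \<H>"
    "\<And>\<gamma> \<tau>. \<gamma> \<in> \<Gamma> \<Longrightarrow> \<tau> \<in> \<H> \<Longrightarrow> sphere_val h (moebius \<gamma> \<tau>) = moebius_sphere \<gamma> (sphere_val h \<tau>)"
  using assms by (auto simp: Eq_def nicely_meromorphic_on_def)

lemma restrict_id_nicely_meromorphic: "restrict (\<lambda>\<tau>. \<tau>) \<H> nicely_meromorphic_on \<H>"
proof (rule nicely_meromorphic_on_cong_open[OF open_H])
  show "(\<lambda>\<tau>. \<tau>) nicely_meromorphic_on \<H>"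
    by (intro analytic_on_imp_nicely_meromorphic_on analytic_intros)
qed simp

text \<open>The vector (t f + e2, f + e1) is multiplied by j times the matrix; the scalar j drops
  out of the quotient. The expression in D' is the denominator at the image point, and its
  non-vanishing is equivalent to that of c h + d.\<close>

lemma ratio_equivariance:
  fixes a b c d e1 e2 f t j :: complex
  assumes j: "j = c * t + d" "j \<noteq> 0" and D: "f + e1 \<noteq> 0"
    and D': "j\<^sup>2 * f + j * (c * e2 + d * e1) \<noteq> 0"
  shows "c * ((t * f + e2) / (f + e1)) + d \<noteq> 0"
    and "((a * t + b) / j * (j\<^sup>2 * f) + j * (a * e2 + b * e1)) / (j\<^sup>2 * f + j * (c * e2 + d * e1)) =
      (a * ((t * f + e2) / (f + e1)) + b) / (c * ((t * f + e2) / (f + e1)) + d)"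
proof -
  let ?h = "(t * f + e2) / (f + e1)"
  have D'_eq: "j\<^sup>2 * f + j * (c * e2 + d * e1) = j * (j * f + c * e2 + d * e1)"
    by (simp add: algebra_simps power2_eq_square)
  have den: "c * ?h + d = (j * f + c * e2 + d * e1) / (f + e1)"
    using D by (simp add: j field_simps)
  have num: "a * ?h + b = ((a * t + b) * f + a * e2 + b * e1) / (f + e1)"
    using D by (simp add: field_simps)
  have nz: "j * f + c * e2 + d * e1 \<noteq> 0" using D' unfolding D'_eq by auto
  then show "c * ?h + d \<noteq> 0" unfolding den using D by simp
  have "(a * t + b) / j * (j\<^sup>2 * f) + j * (a * e2 + b * e1) = j * ((a * t + b) * f + a * e2 + b * e1)"
  proof -
    have "(a * t + b) / j * (j\<^sup>2 * f) = (a * t + b) * (j * f)"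
      using j(2) by (simp add: power2_eq_square)
    then show ?thesis by (simp add: algebra_simps)
  qed
  then show "((a * t + b) / j * (j\<^sup>2 * f) + j * (a * e2 + b * e1)) / (j\<^sup>2 * f + j * (c * e2 + d * e1)) =
      (a * ?h + b) / (c * ?h + d)"
    unfolding D'_eq den num using j(2) D by simp
qed

text \<open>The determinant e2 - t e1 is invariant and h - t is divided by (c h + d) j. Writing c h
  + d = c (h - t) + j produces the factor j^2 and a term in c that cancels the failure of e1 to have
  weight 2.\<close>

lemma inverse_ratio_weight_2:
  fixes a b c d e1 e2 h t j :: complex
  assumes det: "a * d - b * c = 1" and j: "j = c * t + d" "j \<noteq> 0" and ch: "c * h + d \<noteq> 0" and ht: "h \<noteq> t"
  shows "(j * (a * e2 + b * e1) - (a * t + b) / j * (j * (c * e2 + d * e1))) /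
      ((a * h + b) / (c * h + d) - (a * t + b) / j) - j * (c * e2 + d * e1) =
    j\<^sup>2 * ((e2 - t * e1) / (h - t) - e1)"
proof -
  have "(a * t + b) / j * (j * (c * e2 + d * e1)) = (a * t + b) * (c * e2 + d * e1)"
    using j(2) by simp
  moreover have "j * (a * e2 + b * e1) - (a * t + b) * (c * e2 + d * e1) = e2 - t * e1"
    using det unfolding j(1) by algebra
  ultimately have W: "j * (a * e2 + b * e1) - (a * t + b) / j * (j * (c * e2 + d * e1)) = e2 - t * e1"
    by simp
  have "(a * h + b) / (c * h + d) - (a * t + b) / j = ((a * h + b) * j - (a * t + b) * (c * h + d)) / ((c * h + d) * j)"
    using ch j(2) by (simp add: diff_frac_eq)
  also have "(a * h + b) * j - (a * t + b) * (c * h + d) = h - t" using det unfolding j(1) by algebra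
  finally have diff: "(a * h + b) / (c * h + d) - (a * t + b) / j = (h - t) / ((c * h + d) * j)" .
  \<comment> \<open>Multiplying by u = h - t leaves a polynomial identity.\<close>
  have aux: "K / (u / P) - Q = J * (K / u - e)" if "K * P - Q * u = J * (K - e * u)" "u \<noteq> 0"
    for K P Q J u e :: complex
  proof -
    have "(K * P - Q * u) / u = J * (K - e * u) / u" using that(1) by simp
    then show ?thesis using that(2) by (simp add: diff_divide_distrib right_diff_distrib)
  qed
  show ?thesis
    unfolding W diff
  proof (rule aux)
    show "(e2 - t * e1) * ((c * h + d) * j) - j * (c * e2 + d * e1) * (h - t) =
        j\<^sup>2 * (e2 - t * e1 - e1 * (h - t))"
      unfolding j(1) by algebra
  qed (use ht in simp)
qed

text \<open>Numerator and denominator are determinants of (q2, q1) against (e2, e1) and against (t,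
  1). They are multiplied by j / r and 1 / (r j); r, a power of j depending on the weight, cancels,
  and j^2 remains for every weight.\<close>

lemma period_ratio_weight_2:
  fixes a b c d e1 e2 q1 q2 q1' q2' t j r :: complex
  assumes det: "a * d - b * c = 1" and j: "j = c * t + d" "j \<noteq> 0" and r: "r \<noteq> 0"
    and q: "r * q1' = c * q2 + d * q1" "r * q2' = a * q2 + b * q1"
  shows "(q2' * (j * (c * e2 + d * e1)) - q1' * (j * (a * e2 + b * e1))) / ((a * t + b) / j * q1' - q2') =
    j\<^sup>2 * ((q2 * e1 - q1 * e2) / (t * q1 - q2))"
proof -
  have "r * (q2' * (j * (c * e2 + d * e1)) - q1' * (j * (a * e2 + b * e1))) =
      j * ((r * q2') * (c * e2 + d * e1) - (r * q1') * (a * e2 + b * e1))"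
    by (simp add: algebra_simps)
  also have "\<dots> = j * (q2 * e1 - q1 * e2)"
    unfolding q using det by algebra
  finally have num: "q2' * (j * (c * e2 + d * e1)) - q1' * (j * (a * e2 + b * e1)) = j * (q2 * e1 - q1 * e2) / r"
    using r by (simp add: eq_divide_eq mult.commute)
  define m where "m = (a * t + b) / j"
  have m: "m * j = a * t + b" using j(2) by (simp add: m_def)
  have "r * j * (m * q1' - q2') = (m * j) * (r * q1') - j * (r * q2')"
    by algebra
  also have "\<dots> = t * q1 - q2"
    unfolding q m unfolding j(1) using det by algebra
  finally have den: "m * q1' - q2' = (t * q1 - q2) / (r * j)"
    using r j(2) by (simp add: eq_divide_eq mult.commute)
  show ?thesis unfolding num m_def[symmetric] den using r j(2) by (simp add: power2_eq_square)
qed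

context
  fixes \<Gamma> :: "(int^2^2) set"
  assumes \<Gamma>: "subgroup \<Gamma> SL2Z" and index: "finite (rcosets\<^bsub>SL2Z\<^esub> \<Gamma>)"
begin

text \<open>Otherwise f = -\<open>eta1\<close> identically, by the identity theorem. Comparing
  weight 2 of f with \<open>eta_moebius\<close> for an element with c \<noteq> 0 then leaves c j
  (\<open>eta2\<close> - w \<open>eta1\<close>) = 0, against the Legendre determinant.\<close>

lemma eta1_not_weight_2:
  assumes f: "f \<in> M2 \<Gamma>" and \<tau>: "\<tau> \<in> \<H>"
  shows "\<forall>\<^sub>F w in at \<tau>. f w + eta1 w \<noteq> 0"
proof (rule ccontr)
  assume "\<not> ?thesis"
  then have 0: "\<forall>\<tau>\<in>\<H>. \<forall>\<^sub>F w in at \<tau>. f w + eta1 w = 0"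
    using meromorphic_zero_or_eventually_nonzero[OF meromorphic_on_add[OF M2D(3)[OF f] eta_meromorphic(1)]] \<tau>
    by blast
  obtain \<gamma> :: "int^2^2" where \<gamma>: "\<gamma> \<in> \<Gamma>" "\<gamma>$2$1 \<noteq> 0" using finite_index_lower_left_nonzero[OF \<Gamma> index] .
  have det: "det \<gamma> = 1" using subgroup_det[OF \<Gamma> \<gamma>(1)] .
  have "\<forall>\<^sub>F w in at \<tau>. False"
    using bspec[OF 0 \<tau>] eventually_moebius[OF 0 det \<tau>] eventually_in_H[OF \<tau>]
  proof eventually_elim
    case (elim w)
    then have w: "Im w > 0" by (simp add: H_iff)
    let ?j = "automorphy \<gamma> w" and ?c = "of_int (\<gamma>$2$1) :: complex" and ?d = "of_int (\<gamma>$2$2) :: complex"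
    have "?j\<^sup>2 * f w + ?j * (?c * eta2 w + ?d * eta1 w) = 0"
      using elim M2D(4)[OF f \<gamma>(1)] eta_moebius(1)[OF det w] by simp
    moreover have "f w = - eta1 w" using elim by (simp add: eq_neg_iff_add_eq_0)
    ultimately have "?j * ?c * (eta2 w - w * eta1 w) = 0"
      unfolding automorphy_def by algebra
    then show False
      using \<gamma>(2) automorphy_nonzero[OF det w] eta_determinant_nonzero[OF w] by simp
  qed
  then show False by simp
qed

lemma M2_to_Eq_in_Eq:
  assumes f: "f \<in> M2 \<Gamma>"
  shows "M2_to_Eq f \<in> Eq \<Gamma>"
proof -
  let ?g = "\<lambda>\<tau>. (\<tau> * f \<tau> + eta2 \<tau>) / (f \<tau> + eta1 \<tau>)"
  note g = M2_to_Eq_meromorphic[OF M2D(3)[OF f]]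
  let ?h = "M2_to_Eq f"
  have nice: "?h nicely_meromorphic_on \<H>"
    unfolding M2_to_Eq_eta by (rule mero_of_nicely_meromorphic[OF g])
  have ev: "\<forall>\<^sub>F w in at \<tau>. ?h w = ?g w \<and> f w + eta1 w \<noteq> 0 \<and> w \<in> \<H>" if "\<tau> \<in> \<H>" for \<tau>
    using eventually_mero_of[OF g that] eta1_not_weight_2[OF f that] eventually_in_H[OF that]
    unfolding M2_to_Eq_eta by eventually_elim simp
  then have ev': "\<forall>\<tau>\<in>\<H>. \<forall>\<^sub>F w in at \<tau>. ?h w = ?g w \<and> f w + eta1 w \<noteq> 0 \<and> w \<in> \<H>" by blast
  have "sphere_val ?h (moebius \<gamma> \<tau>) = moebius_sphere \<gamma> (sphere_val ?h \<tau>)"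
    if \<gamma>: "\<gamma> \<in> \<Gamma>" and \<tau>: "\<tau> \<in> \<H>" for \<gamma> \<tau>
  proof (rule equivariant_everywhere[OF nice _ \<tau>])
    show det: "det \<gamma> = 1" using subgroup_det[OF \<Gamma> \<gamma>] .
    show "\<forall>\<^sub>F w in at \<tau>. automorphy \<gamma> (?h w) \<noteq> 0 \<and> ?h (moebius \<gamma> w) = moebius \<gamma> (?h w)"
      using ev[OF \<tau>] eventually_moebius[OF ev' det \<tau>]
    proof eventually_elim
      case (elim w)
      then have w: "w \<in> \<H>" "Im w > 0" by (auto simp: H_iff)
      let ?a = "of_int (\<gamma>$1$1) :: complex" and ?b = "of_int (\<gamma>$1$2) :: complex"
      let ?c = "of_int (\<gamma>$2$1) :: complex" and ?d = "of_int (\<gamma>$2$2) :: complex"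
      let ?j = "automorphy \<gamma> w"
      have tr: "f (moebius \<gamma> w) = ?j\<^sup>2 * f w" "eta1 (moebius \<gamma> w) = ?j * (?c * eta2 w + ?d * eta1 w)"
        "eta2 (moebius \<gamma> w) = ?j * (?a * eta2 w + ?b * eta1 w)"
        using M2D(4)[OF f \<gamma> w(1)] eta_moebius[OF det w(2)] by simp_all
      have D: "f w + eta1 w \<noteq> 0" and D': "?j\<^sup>2 * f w + ?j * (?c * eta2 w + ?d * eta1 w) \<noteq> 0"
        using elim by (simp_all add: tr)
      have j: "?j = ?c * w + ?d" by (simp add: automorphy_def)
      note R = ratio_equivariance[OF j automorphy_nonzero[OF det w(2)] D D']
      have h: "?h w = ?g w" and h': "?h (moebius \<gamma> w) = ?g (moebius \<gamma> w)" using elim by simp_all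
      have "automorphy \<gamma> (?h w) \<noteq> 0" using R(1) by (simp add: h automorphy_def)
      moreover have "?h (moebius \<gamma> w) = moebius \<gamma> (?h w)"
        using R(2) unfolding h' tr h by (simp add: moebius_def automorphy_def)
      ultimately show ?case by simp
    qed
  qed
  \<comment> \<open>An identity map here would mean w (f + \<open>eta1\<close>) = w f +
    \<open>eta2\<close>, that is, a vanishing Legendre determinant.\<close>
  moreover have "?h \<noteq> restrict (\<lambda>\<tau>. \<tau>) \<H>"
  proof
    assume id: "?h = restrict (\<lambda>\<tau>. \<tau>) \<H>"
    have "\<forall>\<^sub>F w in at \<i>. False"
      using ev[OF ii_in_H]
    proof eventually_elim
      case (elim w)
      then have "w = ?g w" unfolding id by auto
      then have "w * (f w + eta1 w) = w * f w + eta2 w" using elim by (simp add: eq_divide_eq)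
      then show False using eta_determinant_nonzero[of w] elim by (simp add: H_iff distrib_left)
    qed
    then show False by simp
  qed
  ultimately show ?thesis
    using nice by (simp add: Eq_def M2_to_Eq_eta mero_of_extensional)
qed

lemma Eq_subset_M2_to_Eq:
  assumes h: "h \<in> Eq \<Gamma>"
  shows "\<exists>f\<in>M2 \<Gamma>. M2_to_Eq f = h"
proof -
  let ?F = "\<lambda>\<tau>. (eta2 \<tau> - \<tau> * eta1 \<tau>) / (h \<tau> - \<tau>) - eta1 \<tau>"
  have F: "?F meromorphic_on \<H>"
    by (intro meromorphic_intros eta_meromorphic EqD(3)[OF h])
  define f where "f = mero_of ?F"
  have nice: "f nicely_meromorphic_on \<H>" unfolding f_def by (rule mero_of_nicely_meromorphic[OF F])
  \<comment> \<open>This is the use of the exclusion of the identity from \<open>Eq\<close>: it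
    makes h - \<tau> a legitimate denominator.\<close>
  have "\<not> (\<forall>\<tau>\<in>\<H>. \<forall>\<^sub>F w in at \<tau>. h w - w = 0)"
  proof
    assume 0: "\<forall>\<tau>\<in>\<H>. \<forall>\<^sub>F w in at \<tau>. h w - w = 0"
    have ev: "\<forall>\<^sub>F w in at \<tau>. h w = restrict (\<lambda>\<tau>. \<tau>) \<H> w" if "\<tau> \<in> \<H>" for \<tau>
      using bspec[OF 0 that] eventually_in_H[OF that] by eventually_elim simp
    have "h = restrict (\<lambda>\<tau>. \<tau>) \<H>"
      by (rule nicely_meromorphic_eqI[OF EqD(2,1)[OF h] restrict_id_nicely_meromorphic restrict_extensional ev])
    then show False using EqD(4)[OF h] by contradiction
  qed
  then have ne: "\<forall>\<^sub>F w in at \<tau>. h w - w \<noteq> 0" if "\<tau> \<in> \<H>" for \<tau>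
    using meromorphic_zero_or_eventually_nonzero[OF meromorphic_on_diff[OF EqD(3)[OF h] meromorphic_on_id]] that
    by auto
  have ev: "\<forall>\<^sub>F w in at \<tau>. f w = ?F w \<and> h w \<noteq> w \<and> \<not> is_pole h w \<and> w \<in> \<H>" if "\<tau> \<in> \<H>" for \<tau>
    using eventually_mero_of[OF F that] ne[OF that] eventually_not_pole[OF EqD(3)[OF h] that] eventually_in_H[OF that]
    unfolding f_def by eventually_elim simp
  then have ev': "\<forall>\<tau>\<in>\<H>. \<forall>\<^sub>F w in at \<tau>. f w = ?F w \<and> h w \<noteq> w \<and> \<not> is_pole h w \<and> w \<in> \<H>" by blast
  have "f (moebius \<gamma> \<tau>) = automorphy \<gamma> \<tau> ^ 2 * f \<tau>" if \<gamma>: "\<gamma> \<in> \<Gamma>" and \<tau>: "\<tau> \<in> \<H>" for \<gamma> \<tau>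
  proof (rule weight_2_everywhere[OF nice _ \<tau>])
    show det: "det \<gamma> = 1" using subgroup_det[OF \<Gamma> \<gamma>] .
    show "\<forall>\<^sub>F w in at \<tau>. f (moebius \<gamma> w) = automorphy \<gamma> w ^ 2 * f w"
      using ev[OF \<tau>] eventually_moebius[OF ev' det \<tau>]
    proof eventually_elim
      case (elim w)
      then have w: "w \<in> \<H>" "Im w > 0" by (auto simp: H_iff)
      let ?a = "of_int (\<gamma>$1$1) :: complex" and ?b = "of_int (\<gamma>$1$2) :: complex"
      let ?c = "of_int (\<gamma>$2$1) :: complex" and ?d = "of_int (\<gamma>$2$2) :: complex"
      let ?j = "automorphy \<gamma> w"
      \<comment> \<open>Neither w nor its image is a pole of h, so equivariance in the sphere is an
        equation between finite values; in particular c h(w) + d cannot vanish.\<close>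
      have "moebius_sphere \<gamma> (Some (h w)) = Some (h (moebius \<gamma> w))"
        using EqD(5)[OF h \<gamma> w(1)] elim by (simp add: sphere_val_def)
      then have h': "automorphy \<gamma> (h w) \<noteq> 0" "h (moebius \<gamma> w) = moebius \<gamma> (h w)"
        by (auto split: if_splits)
      have eqs: "h (moebius \<gamma> w) = (?a * h w + ?b) / (?c * h w + ?d)" "moebius \<gamma> w = (?a * w + ?b) / ?j"
        "eta1 (moebius \<gamma> w) = ?j * (?c * eta2 w + ?d * eta1 w)"
        "eta2 (moebius \<gamma> w) = ?j * (?a * eta2 w + ?b * eta1 w)"
        unfolding h'(2) eta_moebius[OF det w(2)] by (simp_all add: moebius_def automorphy_def)
      have j: "?j = ?c * w + ?d" by (simp add: automorphy_def)
      have ch: "?c * h w + ?d \<noteq> 0" using h'(1) by (simp add: automorphy_def)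
      have "f (moebius \<gamma> w) = ?F (moebius \<gamma> w)" using elim by simp
      also have "\<dots> = ?j\<^sup>2 * ?F w"
        unfolding eqs(1,3,4) unfolding eqs(2)
        using elim by (intro inverse_ratio_weight_2[OF det_one_entries(2)[OF det] j automorphy_nonzero[OF det w(2)] ch]) simp
      also have "\<dots> = ?j\<^sup>2 * f w" using elim by simp
      finally show ?case .
    qed
  qed
  then have "f \<in> M2 \<Gamma>" using nice by (simp add: M2_def f_def mero_of_extensional)
  moreover have "M2_to_Eq f = h"
  proof -
    have "M2_to_Eq f = mero_of h"
      unfolding M2_to_Eq_eta
    proof (rule mero_of_cong)
      fix \<tau> assume "\<tau> \<in> \<H>"
      from ev[OF this] show "\<forall>\<^sub>F w in at \<tau>. (w * f w + eta2 w) / (f w + eta1 w) = h w"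
      proof eventually_elim
        case (elim w)
        let ?W = "eta2 w - w * eta1 w"
        have W: "?W \<noteq> 0" using eta_determinant_nonzero[of w] elim by (simp add: H_iff)
        have fe: "f w + eta1 w = ?W / (h w - w)" using elim by simp
        moreover have "w * f w + eta2 w = h w * (?W / (h w - w))"
        proof -
          have "w * f w + eta2 w = w * (f w + eta1 w) + ?W" by algebra
          also have "\<dots> = w * (?W / (h w - w)) + ?W" unfolding fe ..
          also have "\<dots> = (w * ?W + ?W * (h w - w)) / (h w - w)" using elim by (simp add: add_divide_distrib)
          also have "w * ?W + ?W * (h w - w) = h w * ?W" by algebra
          finally show ?thesis by simp
        qed
        ultimately show ?case using W elim by simp
      qed
    qed
    then show ?thesis using mero_of_id EqD(1,2)[OF h] by simp
  qed
  ultimately show ?thesis by blast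
qed

end

section \<open>Elliptic zeta functions and modular forms\<close>

locale nonzero_zeta =
  fixes \<Gamma> :: "(int^2^2) set" and Z :: zeta_fun and k :: int
  assumes subgroup: "subgroup \<Gamma> SL2Z"
    and elliptic: "elliptic_zeta \<Gamma> k Z"
    and Psi_nonzero: "\<exists>\<tau>\<in>\<H>. \<not> polar_class Z (basis_class \<Gamma> (1, \<tau>)) \<and> Psi Z (basis_class \<Gamma> (1, \<tau>)) \<noteq> 0"
begin

definition q1 :: "complex \<Rightarrow> complex" where "q1 \<tau> = quasi_period Z (basis_class \<Gamma> (1, \<tau>)) 1"
definition q2 :: "complex \<Rightarrow> complex" where "q2 \<tau> = quasi_period Z (basis_class \<Gamma> (1, \<tau>)) \<tau>"
definition polar :: "complex set" where "polar = {\<tau>\<in>\<H>. polar_class Z (basis_class \<Gamma> (1, \<tau>))}"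

text \<open>The quotient of the two Cramer numerators of \<open>Phi_Psi_eq\<close>; their common
  determinant has cancelled.\<close>

definition ratio :: "complex \<Rightarrow> complex" where
  "ratio \<tau> = (q2 \<tau> * eta1 \<tau> - q1 \<tau> * eta2 \<tau>) / (\<tau> * q1 \<tau> - q2 \<tau>)"

lemma polar_sparse: "polar sparse_in \<H>"
  and q_holomorphic: "q1 holomorphic_on \<H> - polar" "q2 holomorphic_on \<H> - polar"
  and q_meromorphic: "q1 meromorphic_on \<H>" "q2 meromorphic_on \<H>"
  using elliptic by (simp_all add: elliptic_zeta_def meromorphic_off_def polar_def[symmetric] q1_def[abs_def] q2_def[abs_def] Let_def)

lemma ratio_meromorphic: "ratio meromorphic_on \<H>"
  unfolding ratio_def[abs_def] by (intro meromorphic_intros eta_meromorphic q_meromorphic)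

lemma Phi_Psi_polar:
  assumes "\<tau> \<in> \<H> - polar"
  shows "Phi Z (basis_class \<Gamma> (1, \<tau>)) = (q2 \<tau> * eta1 \<tau> - q1 \<tau> * eta2 \<tau>) / (\<tau> * eta1 \<tau> - eta2 \<tau>)"
    and "Psi Z (basis_class \<Gamma> (1, \<tau>)) = (\<tau> * q1 \<tau> - q2 \<tau>) / (\<tau> * eta1 \<tau> - eta2 \<tau>)"
  using assms Phi_Psi_eq[OF subgroup elliptic, of \<tau>] by (simp_all add: q1_def q2_def polar_def H_iff)

lemma eventually_not_polar:
  assumes "\<tau> \<in> \<H>"
  shows "\<forall>\<^sub>F w in at \<tau>. w \<in> \<H> - polar"
proof -
  have "\<forall>\<^sub>F w in at \<tau>. w \<notin> polar"
    using polar_sparse assms by (simp add: sparse_in_eventually_iff[OF open_H])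
  with eventually_in_H[OF assms] show ?thesis by eventually_elim simp
qed

text \<open>One non-polar point with \<open>Psi\<close> nonzero suffices: holomorphy off the polar
  set gives continuity there, hence non-vanishing nearby, which rules out the identically zero
  case.\<close>

lemma eventually_denominator_nonzero:
  assumes "\<tau> \<in> \<H>"
  shows "\<forall>\<^sub>F w in at \<tau>. w * q1 w - q2 w \<noteq> 0"
proof (rule ccontr)
  assume "\<not> ?thesis"
  moreover have "(\<lambda>w. w * q1 w - q2 w) meromorphic_on \<H>"
    by (intro meromorphic_intros q_meromorphic)
  ultimately have 0: "\<forall>\<tau>\<in>\<H>. \<forall>\<^sub>F w in at \<tau>. w * q1 w - q2 w = 0"
    using meromorphic_zero_or_eventually_nonzero assms by blast
  obtain \<sigma> where \<sigma>: "\<sigma> \<in> \<H> - polar" "Psi Z (basis_class \<Gamma> (1, \<sigma>)) \<noteq> 0"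
    using Psi_nonzero by (auto simp: polar_def)
  then have nz: "\<sigma> * q1 \<sigma> - q2 \<sigma> \<noteq> 0" using Phi_Psi_polar(2)[OF \<sigma>(1)] by auto
  have "(\<lambda>w. w * q1 w - q2 w) holomorphic_on \<H> - polar"
    by (intro holomorphic_intros q_holomorphic)
  then have "isCont (\<lambda>w. w * q1 w - q2 w) \<sigma>"
    using \<sigma>(1) open_diff_sparse_pts[OF open_H polar_sparse]
    by (meson continuous_on_eq_continuous_at holomorphic_on_imp_continuous_on)
  then have "\<forall>\<^sub>F w in at \<sigma>. w * q1 w - q2 w \<noteq> 0"
    using nz by (intro tendsto_imp_eventually_ne) (auto simp: isCont_def)
  moreover have "\<forall>\<^sub>F w in at \<sigma>. w * q1 w - q2 w = 0" using 0 \<sigma>(1) by blast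
  ultimately have "\<forall>\<^sub>F w in at \<sigma>. False" by eventually_elim simp
  then show False by simp
qed

lemma Zeta_to_M2_ratio: "Zeta_to_M2 \<Gamma> Z = mero_of ratio"
  unfolding Zeta_to_M2_def
proof (rule mero_of_cong)
  fix \<tau> assume "\<tau> \<in> \<H>"
  from eventually_not_polar[OF this]
  show "\<forall>\<^sub>F w in at \<tau>. Phi Z (basis_class \<Gamma> (1, w)) / Psi Z (basis_class \<Gamma> (1, w)) = ratio w"
  proof eventually_elim
    case (elim w)
    then show ?case using eta_determinant_nonzero[of w] by (simp add: Phi_Psi_polar ratio_def H_iff)
  qed
qed

lemma Zeta_to_M2_in_M2: "Zeta_to_M2 \<Gamma> Z \<in> M2 \<Gamma>"
proof -
  let ?f = "mero_of ratio"
  have nice: "?f nicely_meromorphic_on \<H>" by (rule mero_of_nicely_meromorphic[OF ratio_meromorphic])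
  have ev: "\<forall>\<tau>\<in>\<H>. \<forall>\<^sub>F w in at \<tau>. ?f w = ratio w"
    using eventually_mero_of[OF ratio_meromorphic] by blast
  have "?f (moebius \<gamma> \<tau>) = automorphy \<gamma> \<tau> ^ 2 * ?f \<tau>" if \<gamma>: "\<gamma> \<in> \<Gamma>" and \<tau>: "\<tau> \<in> \<H>" for \<gamma> \<tau>
  proof (rule weight_2_everywhere[OF nice _ \<tau>])
    show det: "det \<gamma> = 1" using subgroup_det[OF subgroup \<gamma>] .
    show "\<forall>\<^sub>F w in at \<tau>. ?f (moebius \<gamma> w) = automorphy \<gamma> w ^ 2 * ?f w"
      using bspec[OF ev \<tau>] eventually_moebius[OF ev det \<tau>] eventually_not_polar[OF \<tau>]
    proof eventually_elim
      case (elim w)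
      then have w: "Im w > 0" "\<not> polar_class Z (basis_class \<Gamma> (1, w))" by (auto simp: H_iff polar_def)
      let ?a = "of_int (\<gamma>$1$1) :: complex" and ?b = "of_int (\<gamma>$1$2) :: complex"
      let ?c = "of_int (\<gamma>$2$1) :: complex" and ?d = "of_int (\<gamma>$2$2) :: complex"
      let ?j = "automorphy \<gamma> w"
      have j: "?j = ?c * w + ?d" "?j \<noteq> 0"
        using automorphy_nonzero[OF det w(1)] by (simp_all add: automorphy_def)
      have q: "?j powi k * q1 (moebius \<gamma> w) = ?c * q2 w + ?d * q1 w"
        "?j powi k * q2 (moebius \<gamma> w) = ?a * q2 w + ?b * q1 w"
        using quasi_period_moebius[OF subgroup elliptic \<gamma> w] by (simp_all add: q1_def q2_def)
      have m: "moebius \<gamma> w = (?a * w + ?b) / ?j" by (simp add: moebius_def)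
      have "ratio (moebius \<gamma> w) = ((q2 (moebius \<gamma> w) * (?j * (?c * eta2 w + ?d * eta1 w)) -
          q1 (moebius \<gamma> w) * (?j * (?a * eta2 w + ?b * eta1 w))) /
          ((?a * w + ?b) / ?j * q1 (moebius \<gamma> w) - q2 (moebius \<gamma> w)))"
        unfolding ratio_def eta_moebius[OF det w(1)] m[symmetric] ..
      also have "\<dots> = ?j\<^sup>2 * ratio w"
        unfolding ratio_def
        using j by (intro period_ratio_weight_2[OF det_one_entries(2)[OF det] j _ q]) simp
      finally show ?case using elim by simp
    qed
  qed
  then show ?thesis using nice by (simp add: Zeta_to_M2_ratio M2_def mero_of_extensional)
qed

text \<open>With D = w q1 - q2 and W = w \<open>eta1\<close> - \<open>eta2\<close>, numerator and
  denominator of the second map become q2 W / D and q1 W / D, and the nonzero factor W / D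
  cancels.\<close>

lemma Zeta_to_Eq_factors: "Zeta_to_Eq \<Gamma> Z = M2_to_Eq (Zeta_to_M2 \<Gamma> Z)"
  unfolding Zeta_to_Eq_def M2_to_Eq_eta Zeta_to_M2_ratio
proof (rule mero_of_cong)
  fix \<tau> assume \<tau>: "\<tau> \<in> \<H>"
  show "\<forall>\<^sub>F w in at \<tau>. quasi_period Z (basis_class \<Gamma> (1, w)) w / quasi_period Z (basis_class \<Gamma> (1, w)) 1 =
      (w * mero_of ratio w + eta2 w) / (mero_of ratio w + eta1 w)"
    using eventually_mero_of[OF ratio_meromorphic \<tau>] eventually_denominator_nonzero[OF \<tau>] eventually_in_H[OF \<tau>]
  proof eventually_elim
    case (elim w)
    let ?D = "w * q1 w - q2 w" and ?W = "w * eta1 w - eta2 w"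
    have W: "?W \<noteq> 0" using eta_determinant_nonzero[of w] elim by (simp add: H_iff)
    have "w * ratio w + eta2 w = (w * (q2 w * eta1 w - q1 w * eta2 w) + eta2 w * ?D) / ?D"
      using elim by (simp add: ratio_def add_divide_distrib)
    also have "w * (q2 w * eta1 w - q1 w * eta2 w) + eta2 w * ?D = q2 w * ?W" by algebra
    finally have num: "w * ratio w + eta2 w = q2 w * ?W / ?D" .
    have "ratio w + eta1 w = (q2 w * eta1 w - q1 w * eta2 w + eta1 w * ?D) / ?D"
      using elim by (simp add: ratio_def add_divide_distrib)
    also have "q2 w * eta1 w - q1 w * eta2 w + eta1 w * ?D = q1 w * ?W" by algebra
    finally have den: "ratio w + eta1 w = q1 w * ?W / ?D" .
    have "q2 w / q1 w = (w * ratio w + eta2 w) / (ratio w + eta1 w)"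
      unfolding num den using W elim by simp
    then show ?case using elim by (simp add: q1_def q2_def)
  qed
qed

end

section \<open>The elliptic zeta function of a weight 2 form\<close>

lemma Zeta_nonzero_zeta:
  assumes "subgroup \<Gamma> SL2Z" "Z \<in> Zeta \<Gamma>"
  obtains k where "nonzero_zeta \<Gamma> Z k"
  using assms by (auto simp: Zeta_def nonzero_zeta_def)

text \<open>The value is computed from an arbitrarily chosen representative; dividing by the square
  of \<omega>1 balances weight 2 and makes the choice immaterial. Poles of f are turned into polar
  classes, whereas lattice points are only poles in z.\<close>

definition zeta_of_form :: "(int^2^2) set \<Rightarrow> (complex \<Rightarrow> complex) \<Rightarrow> zeta_fun" where
  "zeta_of_form \<Gamma> f = restrict (\<lambda>C z. case SOME p. p \<in> C of (\<omega>1, \<omega>2) \<Rightarrow>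
     if is_pole f (\<omega>2 / \<omega>1) \<or> z \<in> \<Lambda> (\<omega>1, \<omega>2) then None
     else Some (f (\<omega>2 / \<omega>1) * z / \<omega>1\<^sup>2 + weierstrass_zeta (\<Lambda> (\<omega>1, \<omega>2)) z)) (\<Omega> \<Gamma>)"

context
  fixes \<Gamma> :: "(int^2^2) set" and f :: "complex \<Rightarrow> complex"
  assumes \<Gamma>: "subgroup \<Gamma> SL2Z" and f: "f \<in> M2 \<Gamma>"
begin

text \<open>Derived from \<open>sphere_val\<close> rather than from the pointwise law, since a
  stored value 0 does not tell a pole from a zero.\<close>

lemma is_pole_moebius:
  assumes "\<gamma> \<in> \<Gamma>" "\<tau> \<in> \<H>"
  shows "is_pole f (moebius \<gamma> \<tau>) \<longleftrightarrow> is_pole f \<tau>"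
proof -
  have "\<forall>\<^sub>F w in at \<tau>. f (moebius \<gamma> w) = automorphy \<gamma> w ^ 2 * f w"
    using eventually_in_H[OF assms(2)] by eventually_elim (rule M2D(4)[OF f assms(1)])
  from sphere_val_moebius_weight_2[OF M2D(2)[OF f] subgroup_det[OF \<Gamma> assms(1)] assms(2) this]
  show ?thesis by (auto simp: sphere_val_def split: if_splits)
qed

text \<open>Independence of the representative: \<gamma> multiplies the first basis vector by j and
  f by j^2, and it preserves the lattice.\<close>

lemma zeta_of_form_class:
  assumes p: "(\<omega>1, \<omega>2) \<in> bases"
  shows "zeta_of_form \<Gamma> f (basis_class \<Gamma> (\<omega>1, \<omega>2)) z =
    (if is_pole f (\<omega>2 / \<omega>1) \<or> z \<in> \<Lambda> (\<omega>1, \<omega>2) then None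
     else Some (f (\<omega>2 / \<omega>1) * z / \<omega>1\<^sup>2 + weierstrass_zeta (\<Lambda> (\<omega>1, \<omega>2)) z))"
proof -
  let ?C = "basis_class \<Gamma> (\<omega>1, \<omega>2)"
  have "(SOME p. p \<in> ?C) \<in> ?C" using basis_in_class[OF \<Gamma>] by (metis someI)
  then obtain \<gamma> where \<gamma>: "\<gamma> \<in> \<Gamma>" "(SOME p. p \<in> ?C) = basis_act \<gamma> (\<omega>1, \<omega>2)"
    by (auto simp only: basis_class_def)
  have det: "det \<gamma> = 1" using subgroup_det[OF \<Gamma> \<gamma>(1)] .
  have t: "\<omega>2 / \<omega>1 \<in> \<H>" using p by (simp add: bases_def H_iff)
  then have w: "\<omega>1 \<noteq> 0" by (auto simp: H_iff)
  obtain \<alpha> where \<alpha>: "\<alpha> \<noteq> 0" "\<alpha> = automorphy \<gamma> (\<omega>2 / \<omega>1) * \<omega>1"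
      "basis_act \<gamma> (\<omega>1, \<omega>2) = (\<alpha>, \<alpha> * moebius \<gamma> (\<omega>2 / \<omega>1))"
    using basis_act_ratio[OF det p] .
  have L: "\<Lambda> (\<alpha>, \<alpha> * moebius \<gamma> (\<omega>2 / \<omega>1)) = \<Lambda> (\<omega>1, \<omega>2)"
    using period_lattice_act[OF det, of "(\<omega>1, \<omega>2)"] by (simp only: \<alpha>(3))
  have "f (moebius \<gamma> (\<omega>2 / \<omega>1)) * z / \<alpha>\<^sup>2 = f (\<omega>2 / \<omega>1) * z / \<omega>1\<^sup>2"
    using \<alpha>(1) w unfolding M2D(4)[OF f \<gamma>(1) t] \<alpha>(2) by (simp add: power_mult_distrib)
  moreover have "(SOME p. p \<in> ?C) = (\<alpha>, \<alpha> * moebius \<gamma> (\<omega>2 / \<omega>1))"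
    using \<gamma>(2) \<alpha>(3) by (rule trans)
  ultimately show ?thesis
    using \<alpha>(1) basis_class_in_Omega[OF \<Gamma> p] is_pole_moebius[OF \<gamma>(1) t]
    by (simp add: zeta_of_form_def L)
qed

lemma has_quasi_period_zeta_of_form:
  assumes p: "(\<omega>1, \<omega>2) \<in> bases" and \<omega>: "\<omega> \<in> \<Lambda> (\<omega>1, \<omega>2)"
  shows "has_quasi_period (zeta_of_form \<Gamma> f) (basis_class \<Gamma> (\<omega>1, \<omega>2)) \<omega>
    (f (\<omega>2 / \<omega>1) * \<omega> / \<omega>1\<^sup>2 + eta (\<Lambda> (\<omega>1, \<omega>2)) \<omega>)"
  unfolding has_quasi_period_def zeta_of_form_class[OF p]
  using weierstrass_zeta_add_period[OF p \<omega>] period_lattice_add_iff[OF \<omega>]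
  by (simp add: distrib_left add_divide_distrib)

lemma polar_class_zeta_of_form:
  assumes p: "(\<omega>1, \<omega>2) \<in> bases"
  shows "polar_class (zeta_of_form \<Gamma> f) (basis_class \<Gamma> (\<omega>1, \<omega>2)) \<longleftrightarrow> is_pole f (\<omega>2 / \<omega>1)"
  using nonlattice_exists[OF p] by (auto simp: polar_class_def zeta_of_form_class[OF p])

lemma quasi_period_zeta_of_form:
  assumes "\<tau> \<in> \<H>" "\<not> is_pole f \<tau>"
  shows "quasi_period (zeta_of_form \<Gamma> f) (basis_class \<Gamma> (1, \<tau>)) \<tau> = f \<tau> * \<tau> + eta2 \<tau>"
    and "quasi_period (zeta_of_form \<Gamma> f) (basis_class \<Gamma> (1, \<tau>)) 1 = f \<tau> + eta1 \<tau>"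
proof -
  have p: "(1, \<tau>) \<in> bases" using assms by (simp add: standard_basis H_iff)
  have np: "\<not> polar_class (zeta_of_form \<Gamma> f) (basis_class \<Gamma> (1, \<tau>))"
    using assms polar_class_zeta_of_form[OF p] by simp
  show "quasi_period (zeta_of_form \<Gamma> f) (basis_class \<Gamma> (1, \<tau>)) \<tau> = f \<tau> * \<tau> + eta2 \<tau>"
    "quasi_period (zeta_of_form \<Gamma> f) (basis_class \<Gamma> (1, \<tau>)) 1 = f \<tau> + eta1 \<tau>"
    using quasi_period_eqI[OF has_quasi_period_zeta_of_form[OF p, of \<tau>] np]
      quasi_period_eqI[OF has_quasi_period_zeta_of_form[OF p, of 1] np] generators_in_lattice[of "(1, \<tau>)"]
    by (simp_all add: eta1_def eta2_def)
qed

text \<open>Treats both quasi-periods at once: g = \<tau>, e = \<open>eta2\<close> for the period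
  \<tau>, and g = 1, e = \<open>eta1\<close> for the period 1.\<close>

lemma meromorphic_off_poles:
  assumes "g holomorphic_on \<H>" "e holomorphic_on \<H>"
    and "\<And>\<tau>. \<tau> \<in> \<H> \<Longrightarrow> \<not> is_pole f \<tau> \<Longrightarrow> q \<tau> = f \<tau> * g \<tau> + e \<tau>"
  shows "meromorphic_off q {\<tau>\<in>\<H>. is_pole f \<tau>} \<H>"
proof -
  let ?S = "{\<tau>\<in>\<H>. is_pole f \<tau>}"
  have np: "\<forall>\<^sub>F w in at \<tau>. w \<in> \<H> \<and> \<not> is_pole f w" if "\<tau> \<in> \<H>" for \<tau>
    using eventually_not_pole[OF M2D(3)[OF f] that] eventually_in_H[OF that] by eventually_elim simp
  have sparse: "?S sparse_in \<H>"
    unfolding sparse_in_eventually_iff[OF open_H]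
  proof
    fix \<tau> assume "\<tau> \<in> \<H>"
    from np[OF this] show "\<forall>\<^sub>F w in at \<tau>. w \<notin> ?S" by eventually_elim simp
  qed
  have "f analytic_on \<H> - ?S"
    using nicely_meromorphic_on_imp_analytic_at[OF M2D(2)[OF f]] by (subst analytic_on_analytic_at) auto
  then have "(\<lambda>\<tau>. f \<tau> * g \<tau> + e \<tau>) holomorphic_on \<H> - ?S"
    using assms(1,2) by (intro holomorphic_intros) (auto intro: analytic_imp_holomorphic holomorphic_on_subset)
  then have hol: "q holomorphic_on \<H> - ?S"
    by (rule holomorphic_transform) (use assms(3) in auto)
  have "(\<lambda>\<tau>. f \<tau> * g \<tau> + e \<tau>) meromorphic_on \<H>"
    using assms(1,2) open_H
    by (intro meromorphic_intros M2D(3)[OF f]) (simp_all add: analytic_on_imp_meromorphic_on analytic_on_open)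
  moreover have "\<forall>\<^sub>F w in at \<tau>. f w * g w + e w = q w" if "\<tau> \<in> \<H>" for \<tau>
    using np[OF that] by eventually_elim (simp add: assms(3))
  ultimately have "q meromorphic_on \<H>" using meromorphic_on_cong[of \<H> "\<lambda>\<tau>. f \<tau> * g \<tau> + e \<tau>" q \<H>] by simp
  then show ?thesis using sparse hol by (simp add: meromorphic_off_def)
qed

lemma elliptic_zeta_of_form: "elliptic_zeta \<Gamma> (-1) (zeta_of_form \<Gamma> f)"
proof -
  let ?Z = "zeta_of_form \<Gamma> f"
  have "\<exists>h. has_quasi_period ?Z (basis_class \<Gamma> p) \<omega> h" if "p \<in> bases" "\<omega> \<in> \<Lambda> p" for p \<omega>
    using has_quasi_period_zeta_of_form that by (cases p) blast
  moreover have "?Z (scale_class \<alpha> C) (\<alpha> * z) = map_option (\<lambda>w. \<alpha> powi (-1) * w) (?Z C z)"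
    if \<alpha>: "\<alpha> \<noteq> 0" and "C \<in> \<Omega> \<Gamma>" for \<alpha> C z
  proof -
    obtain \<omega>1 \<omega>2 where p: "(\<omega>1, \<omega>2) \<in> bases" and C: "C = basis_class \<Gamma> (\<omega>1, \<omega>2)"
      using \<open>C \<in> \<Omega> \<Gamma>\<close> by (auto simp: Omega_def)
    have p': "(\<alpha> * \<omega>1, \<alpha> * \<omega>2) \<in> bases" and ratio: "\<alpha> * \<omega>2 / (\<alpha> * \<omega>1) = \<omega>2 / \<omega>1"
      using p \<alpha> by (simp_all add: bases_def)
    have mem: "\<alpha> * z \<in> (*) \<alpha> ` \<Lambda> (\<omega>1, \<omega>2) \<longleftrightarrow> z \<in> \<Lambda> (\<omega>1, \<omega>2)" using \<alpha> by auto
    \<comment> \<open>Both summands scale by \<alpha>^-1: the linear one gains \<alpha> from z and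
      \<alpha>^-2 from the square of \<omega>1, and zeta is homogeneous of degree -1.\<close>
    show ?thesis
      unfolding C scale_basis_class zeta_of_form_class[OF p] zeta_of_form_class[OF p'] ratio
        period_lattice_scale mem weierstrass_zeta_scale[OF \<alpha>]
      using \<alpha> by (simp add: power_int_minus power2_eq_square field_simps)
  qed
  moreover have "{\<tau>\<in>\<H>. polar_class ?Z (basis_class \<Gamma> (1, \<tau>))} = {\<tau>\<in>\<H>. is_pole f \<tau>}"
    using polar_class_zeta_of_form[of 1] standard_basis by (auto simp: H_iff)
  moreover have "meromorphic_off (\<lambda>\<tau>. quasi_period ?Z (basis_class \<Gamma> (1, \<tau>)) \<tau>) {\<tau>\<in>\<H>. is_pole f \<tau>} \<H>"
    by (rule meromorphic_off_poles[where g = "\<lambda>\<tau>. \<tau>" and e = eta2])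
      (auto intro: holomorphic_intros eta_holomorphic quasi_period_zeta_of_form)
  moreover have "meromorphic_off (\<lambda>\<tau>. quasi_period ?Z (basis_class \<Gamma> (1, \<tau>)) 1) {\<tau>\<in>\<H>. is_pole f \<tau>} \<H>"
    by (rule meromorphic_off_poles[where g = "\<lambda>\<tau>. 1" and e = eta1])
      (auto intro: holomorphic_intros eta_holomorphic simp: quasi_period_zeta_of_form)
  ultimately show ?thesis
    unfolding elliptic_zeta_def Let_def by (simp add: zeta_of_form_def)
qed

lemma Phi_Psi_zeta_of_form:
  assumes "\<tau> \<in> \<H>" "\<not> is_pole f \<tau>"
  shows "Phi (zeta_of_form \<Gamma> f) (basis_class \<Gamma> (1, \<tau>)) = f \<tau>"
    and "Psi (zeta_of_form \<Gamma> f) (basis_class \<Gamma> (1, \<tau>)) = 1"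
proof -
  have t: "Im \<tau> > 0" using assms by (simp add: H_iff)
  have np: "\<not> polar_class (zeta_of_form \<Gamma> f) (basis_class \<Gamma> (1, \<tau>))"
    using assms polar_class_zeta_of_form[OF standard_basis[OF t]] by simp
  have W: "\<tau> * eta1 \<tau> - eta2 \<tau> \<noteq> 0" using eta_determinant_nonzero[OF t] .
  note eqs = Phi_Psi_eq[OF \<Gamma> elliptic_zeta_of_form t np] quasi_period_zeta_of_form[OF assms]
  have "(f \<tau> * \<tau> + eta2 \<tau>) * eta1 \<tau> - (f \<tau> + eta1 \<tau>) * eta2 \<tau> = f \<tau> * (\<tau> * eta1 \<tau> - eta2 \<tau>)"
    "\<tau> * (f \<tau> + eta1 \<tau>) - (f \<tau> * \<tau> + eta2 \<tau>) = \<tau> * eta1 \<tau> - eta2 \<tau>"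
    by algebra+
  then show "Phi (zeta_of_form \<Gamma> f) (basis_class \<Gamma> (1, \<tau>)) = f \<tau>"
    "Psi (zeta_of_form \<Gamma> f) (basis_class \<Gamma> (1, \<tau>)) = 1"
    using W unfolding eqs by simp_all
qed

lemma eventually_H_not_pole:
  assumes "\<tau> \<in> \<H>"
  shows "\<forall>\<^sub>F w in at \<tau>. w \<in> \<H> \<and> \<not> is_pole f w"
  using eventually_not_pole[OF M2D(3)[OF f] assms] eventually_in_H[OF assms] by eventually_elim simp

lemma zeta_of_form_in_Zeta: "zeta_of_form \<Gamma> f \<in> Zeta \<Gamma>"
proof -
  obtain \<tau> where "\<tau> \<in> \<H>" "\<not> is_pole f \<tau>"
    using eventually_happens[OF eventually_H_not_pole[OF ii_in_H]] by auto
  then show ?thesis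
    using elliptic_zeta_of_form Phi_Psi_zeta_of_form(2)[of \<tau>] polar_class_zeta_of_form[of 1 \<tau>] standard_basis[of \<tau>]
    by (auto simp: Zeta_def H_iff)
qed

lemma Zeta_to_M2_zeta_of_form: "Zeta_to_M2 \<Gamma> (zeta_of_form \<Gamma> f) = f"
proof -
  have "Zeta_to_M2 \<Gamma> (zeta_of_form \<Gamma> f) = mero_of f"
    unfolding Zeta_to_M2_def
  proof (rule mero_of_cong)
    fix \<tau> assume "\<tau> \<in> \<H>"
    from eventually_H_not_pole[OF this]
    show "\<forall>\<^sub>F w in at \<tau>. Phi (zeta_of_form \<Gamma> f) (basis_class \<Gamma> (1, w)) / Psi (zeta_of_form \<Gamma> f) (basis_class \<Gamma> (1, w)) = f w"
      by eventually_elim (simp add: Phi_Psi_zeta_of_form)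
  qed
  then show ?thesis using mero_of_id M2D(1,2)[OF f] by simp
qed

end

theorem mainTheorem1:
  fixes \<Gamma> :: "(int^2^2) set"
  assumes "subgroup \<Gamma> SL2Z"
    and "finite (rcosets\<^bsub>SL2Z\<^esub> \<Gamma>)"
  shows "Zeta_to_M2 \<Gamma> \<in> Zeta \<Gamma> \<rightarrow> M2 \<Gamma> \<and>
         M2_to_Eq \<in> M2 \<Gamma> \<rightarrow> Eq \<Gamma> \<and>
         Zeta_to_Eq \<Gamma> \<in> Zeta \<Gamma> \<rightarrow> Eq \<Gamma> \<and>
         Zeta_to_M2 \<Gamma> ` Zeta \<Gamma> = M2 \<Gamma> \<and>
         M2_to_Eq ` M2 \<Gamma> = Eq \<Gamma> \<and>
         Zeta_to_Eq \<Gamma> ` Zeta \<Gamma> = Eq \<Gamma> \<and>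
         (\<forall>Z\<in>Zeta \<Gamma>. Zeta_to_Eq \<Gamma> Z = M2_to_Eq (Zeta_to_M2 \<Gamma> Z))"
proof -
  have first: "Zeta_to_M2 \<Gamma> Z \<in> M2 \<Gamma>" and commutes: "Zeta_to_Eq \<Gamma> Z = M2_to_Eq (Zeta_to_M2 \<Gamma> Z)"
    if Z: "Z \<in> Zeta \<Gamma>" for Z
  proof -
    obtain k where "nonzero_zeta \<Gamma> Z k" using Zeta_nonzero_zeta[OF assms(1) Z] .
    then interpret nonzero_zeta \<Gamma> Z k .
    show "Zeta_to_M2 \<Gamma> Z \<in> M2 \<Gamma>" by (rule Zeta_to_M2_in_M2)
    show "Zeta_to_Eq \<Gamma> Z = M2_to_Eq (Zeta_to_M2 \<Gamma> Z)" by (rule Zeta_to_Eq_factors)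
  qed
  have onto1: "Zeta_to_M2 \<Gamma> ` Zeta \<Gamma> = M2 \<Gamma>"
    using first zeta_of_form_in_Zeta[OF assms(1)] Zeta_to_M2_zeta_of_form[OF assms(1)]
    by (auto simp: image_iff) metis
  have onto2: "M2_to_Eq ` M2 \<Gamma> = Eq \<Gamma>"
    using M2_to_Eq_in_Eq[OF assms] Eq_subset_M2_to_Eq[OF assms] by blast
  \<comment> \<open>Commutativity reduces the third map to the composite of two surjections, which
    settles its range and its surjectivity together.\<close>
  have "Zeta_to_Eq \<Gamma> ` Zeta \<Gamma> = (\<lambda>Z. M2_to_Eq (Zeta_to_M2 \<Gamma> Z)) ` Zeta \<Gamma>"
    using commutes by (rule image_cong[OF refl])
  also have "\<dots> = Eq \<Gamma>" by (simp only: image_image[symmetric] onto1 onto2)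
  finally have onto3: "Zeta_to_Eq \<Gamma> ` Zeta \<Gamma> = Eq \<Gamma>" .
  show ?thesis using first commutes onto1 onto2 onto3 by auto
qed

end
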